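(* Let $V\in C^1(\mathbb{R},[0,\infty))$ and let $(\mu_{n,t})_{n\in\mathbb{N}}$ be the time-evolved measures obtained at time $t$ from the sequence of finite-volume mean-field Gibbs measures with potential $V$ under independent Brownian motions. For $t\in(0,\infty)$ and $\alpha\in\mathbb{R}$ consider the function $$r\mapsto V(r)+\frac{r^2}{2}+\frac{(r-\alpha)^2}{2t}-\inf_{s\in\mathbb{R}}\Big[V(s)+\frac{s^2}{2}+\frac{(s-\alpha)^2}{2t}\Big],\qquad r\in\mathbb{R}.\qquad( * )$$ Then for every $t\in(0,\infty)$: (a) $\alpha\in\mathbb{R}$ is a good magnetisation for $(\mu_{n,t})_{n\in\mathbb{N}}$ if and only if $( * )$ has a unique global minimiser. (b) If $\alpha\in\mathbb{R}$ is a good magnetisation for $(\mu_{n,t})_{n\in\mathbb{N}}$ and $q$ is the unique global minimiser of $( * )$, then the limiting probability measure $\gamma_\alpha$ in the definition of good magnetisation is $\gamma_\alpha=\mu_{\mathcal{N}(-V'(q),1+t)}$. (c) $(\mu_{n,t})_{n\in\mathbb{N}}$ is sequentially Gibbs if and only if $( * )$ has a unique global minimiser for all $\alpha\in\mathbb{R}$.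
   Context: $\mathcal{B}(\cdot)$ denotes the Borel $\sigma$-algebra. $\mu_{\mathcal{N}(v,A)}$ is the normal distribution with mean $v$ and (co)variance $A$; $I_n$ is the $n\times n$ identity matrix. The empirical magnetisation is $m_n(x_1,\dots,x_n)=\frac1n\sum_{i=1}^n x_i$. Time-evolved measures: for a potential $V\colon\mathbb{R}\to[0,\infty)$, the initial measures are $\mu_{n,0}(A)=\frac1{Z_n}\int_{\mathbb{R}^n}\mathbf{1}_A(z)e^{-nV(m_n(z))}\,d\mu_{\mathcal{N}(0,I_n)}(z)$ with $Z_n$ the normalising constant (the sequence of finite-volume mean-field Gibbs measures with potential $V$), and for $t>0$ $$\mu_{n,t}(A)=\frac1{Z_n}\int_{\mathbb{R}^n}\mu_{\mathcal{N}(z,tI_n)}(A)\,e^{-nV(m_n(z))}\,d\mu_{\mathcal{N}(0,I_n)}(z)\qquad(A\in\mathcal{B}(\mathbb{R}^n)).$$ For a probability measure $\rho_n$ on $\mathcal{B}(\mathbb{R}^n)$, $n\ge2$, let $\pi_{(2:n)}(y_1,\dots,y_n)=(y_2,\dots,y_n)$. A regular conditional probability under $\rho_n$ of the first spin given the other spins is a transition kernel $\gamma_n\colon\mathbb{R}^{n-1}\times\mathcal{B}(\mathbb{R})\to[0,1]$ with $\rho_n(A\times B)=\int \mathbf{1}_B(y)\,\gamma_n(y,A)\,d[\rho_n\circ\pi_{(2:n)}^{-1}](y)$ for all $A\in\mathcal{B}(\mathbb{R})$, $B\in\mathcal{B}(\mathbb{R}^{n-1})$. It is proper if $\gamma_n(y,\cdot)=0$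 for all $y$ outside the support of $\rho_n\circ\pi_{(2:n)}^{-1}$, and weakly continuous if $y\mapsto\gamma_n(y,\cdot)$ is continuous for the weak topology; a weakly continuous proper one is unique if it exists (and it exists for $\rho_n=\mu_{n,t}$). Let $(\rho_n)_{n\in\mathbb{N}}$ be probability measures on $\mathcal{B}(\mathbb{R}^n)$ such that for every $n\ge 2$ a weakly continuous proper regular conditional probability $\gamma_n$ of the first spin given the other spins exists. Then $\alpha\in\mathbb{R}$ is a good magnetisation for $(\rho_n)$ if there is a probability measure $\gamma_\alpha$ on $\mathcal{B}(\mathbb{R})$ such that $\gamma_n(v_{n-1},\cdot)\to\gamma_\alpha$ weakly for all sequences $(v_{n-1})_{n\ge2}$ with $v_{n-1}\in\mathbb{R}^{n-1}$ and $m_{n-1}(v_{n-1})\to\alpha$. The sequence $(\rho_n)$ is sequentially Gibbs if all $\alpha\in\mathbb{R}$ are good magnetisations. *)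

theory Defs
  imports "HOL-Probability.Probability"
begin

section \<open>Euclidean space of varying dimension\<close>

text \<open>
  The space of \<open>n\<close> real spins consists of the functions on \<open>{..<n}\<close> that are \<open>undefined\<close> elsewhere,
  so the first spin has index \<open>0\<close>. The finite product \<open>\<sigma>\<close>-algebra on it is the Borel \<open>\<sigma>\<close>-algebra of
  the topology \<open>spin_topology\<close>, and both have the same carrier.
\<close>

abbreviation spins :: "nat \<Rightarrow> (nat \<Rightarrow> real) measure" where
  "spins n \<equiv> \<Pi>\<^sub>M i\<in>{..<n}. borel"

abbreviation spin_topology :: "nat \<Rightarrow> (nat \<Rightarrow> real) topology" where
  "spin_topology n \<equiv> product_topology (\<lambda>_. euclideanreal) {..<n}"

definition magnetisation :: "nat \<Rightarrow> (nat \<Rightarrow> real) \<Rightarrow> real" where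
  "magnetisation n x = (\<Sum>i<n. x i) / real n"

text \<open>The projection dropping the first spin; the remaining spins are renumbered from \<open>0\<close>.\<close>

definition drop_first :: "nat \<Rightarrow> (nat \<Rightarrow> real) \<Rightarrow> (nat \<Rightarrow> real)" where
  "drop_first n y = (\<lambda>i\<in>{..<n - 1}. y (Suc i))"

lemma topspace_spin_topology: "topspace (spin_topology n) = space (spins n)"
  by (simp add: space_PiM)

section \<open>Normal distributions\<close>

text \<open>The second parameter is the variance, whereas \<^const>\<open>normal_density\<close> expects the standard deviation.\<close>

definition normal_distr :: "real \<Rightarrow> real \<Rightarrow> real measure" where
  "normal_distr a v = density lborel (normal_density a (sqrt v))"

text \<open>Mean vector \<open>z\<close> and covariance matrix \<open>v\<close> times the identity.\<close>

definition iso_normal_distr :: "nat \<Rightarrow> (nat \<Rightarrow> real) \<Rightarrow> real \<Rightarrow> (nat \<Rightarrow> real) measure" where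
  "iso_normal_distr n z v = (\<Pi>\<^sub>M i\<in>{..<n}. normal_distr (z i) v)"

section \<open>Mean-field Gibbs measures and their time evolution\<close>

definition partition_function :: "(real \<Rightarrow> real) \<Rightarrow> nat \<Rightarrow> real" where
  "partition_function V n =
     (\<integral>z. exp (- (real n * V (magnetisation n z))) \<partial>iso_normal_distr n (\<lambda>_. 0) 1)"

definition mean_field_gibbs :: "(real \<Rightarrow> real) \<Rightarrow> nat \<Rightarrow> (nat \<Rightarrow> real) measure" where
  "mean_field_gibbs V n = density (iso_normal_distr n (\<lambda>_. 0) 1)
     (\<lambda>z. ennreal (exp (- (real n * V (magnetisation n z))) / partition_function V n))"

text \<open>Integration of the heat kernel against the initial measure, see \<open>emeasure_time_evolved\<close> below.\<close>

definition time_evolved :: "(real \<Rightarrow> real) \<Rightarrow> real \<Rightarrow> nat \<Rightarrow> (nat \<Rightarrow> real) measure" where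
  "time_evolved V t n = mean_field_gibbs V n \<bind> (\<lambda>z. iso_normal_distr n z t)"

section \<open>Good magnetisations\<close>

text \<open>
  Weak convergence of finite measures, tested against bounded continuous functions. Kernels may take
  the zero measure as a value, hence \<^const>\<open>weak_conv_m\<close>, which is phrased through distribution
  functions, is not used; for probability measures the two notions agree, see
  \<open>converges_weakly_iff_weak_conv_m\<close>.
\<close>

definition converges_weakly :: "(nat \<Rightarrow> real measure) \<Rightarrow> real measure \<Rightarrow> bool" where
  "converges_weakly \<mu> \<nu> \<longleftrightarrow>
     (\<forall>f :: real \<Rightarrow> real. continuous_on UNIV f \<and> bounded (range f) \<longrightarrow>
        (\<lambda>n. \<integral>x. f x \<partial>\<mu> n) \<longlonglongrightarrow> (\<integral>x. f x \<partial>\<nu>))"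

text \<open>
  Continuity into the weak topology, the initial topology of the integrals of bounded continuous
  functions.
\<close>

definition weakly_continuous_kernel :: "nat \<Rightarrow> ((nat \<Rightarrow> real) \<Rightarrow> real measure) \<Rightarrow> bool" where
  "weakly_continuous_kernel m \<gamma> \<longleftrightarrow>
     (\<forall>f :: real \<Rightarrow> real. continuous_on UNIV f \<and> bounded (range f) \<longrightarrow>
        continuous_map (spin_topology m) euclideanreal (\<lambda>y. \<integral>x. f x \<partial>\<gamma> y))"

definition spin_support :: "nat \<Rightarrow> (nat \<Rightarrow> real) measure \<Rightarrow> (nat \<Rightarrow> real) set" where
  "spin_support m \<nu> =
     {y \<in> space (spins m). \<forall>U. openin (spin_topology m) U \<and> y \<in> U \<longrightarrow> emeasure \<nu> U > 0}"

definition regular_cond_prob_first ::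
    "nat \<Rightarrow> (nat \<Rightarrow> real) measure \<Rightarrow> ((nat \<Rightarrow> real) \<Rightarrow> real measure) \<Rightarrow> bool" where
  "regular_cond_prob_first n \<rho> \<gamma> \<longleftrightarrow>
     \<gamma> \<in> spins (n - 1) \<rightarrow>\<^sub>M subprob_algebra borel \<and>
     (\<forall>A \<in> sets borel. \<forall>B \<in> sets (spins (n - 1)).
        emeasure \<rho> {x \<in> space (spins n). x 0 \<in> A \<and> drop_first n x \<in> B} =
        (\<integral>\<^sup>+y. indicator B y * emeasure (\<gamma> y) A \<partial>distr \<rho> (spins (n - 1)) (drop_first n)))"

definition proper_kernel ::
    "nat \<Rightarrow> (nat \<Rightarrow> real) measure \<Rightarrow> ((nat \<Rightarrow> real) \<Rightarrow> real measure) \<Rightarrow> bool" where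
  "proper_kernel n \<rho> \<gamma> \<longleftrightarrow>
     (\<forall>y \<in> space (spins (n - 1)) - spin_support (n - 1) (distr \<rho> (spins (n - 1)) (drop_first n)).
        \<gamma> y = null_measure borel)"

text \<open>
  The kernels \<open>\<gamma> n\<close> are unique on \<open>space (spins (n - 1))\<close>, so quantifying them existentially just
  expresses that they exist and have the required limits. Of the sequence \<open>v\<close>, only the entries
  \<open>v (n - 1)\<close>, a configuration of \<open>n - 1\<close> spins, with \<open>n \<ge> 2\<close> matter.
\<close>

definition limiting_cond_prob ::
    "(nat \<Rightarrow> (nat \<Rightarrow> real) measure) \<Rightarrow> real \<Rightarrow> real measure \<Rightarrow> bool" where
  "limiting_cond_prob \<rho> \<alpha> \<nu> \<longleftrightarrow>
     prob_space \<nu> \<and> sets \<nu> = sets borel \<and>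
     (\<exists>\<gamma>. (\<forall>n\<ge>2. regular_cond_prob_first n (\<rho> n) (\<gamma> n) \<and> proper_kernel n (\<rho> n) (\<gamma> n) \<and>
                   weakly_continuous_kernel (n - 1) (\<gamma> n)) \<and>
          (\<forall>v. (\<forall>n\<ge>2. v (n - 1) \<in> space (spins (n - 1))) \<and>
               (\<lambda>n. magnetisation (n - 1) (v (n - 1))) \<longlonglongrightarrow> \<alpha> \<longrightarrow>
               converges_weakly (\<lambda>n. \<gamma> n (v (n - 1))) \<nu>))"

definition good_magnetisation :: "(nat \<Rightarrow> (nat \<Rightarrow> real) measure) \<Rightarrow> real \<Rightarrow> bool" where
  "good_magnetisation \<rho> \<alpha> \<longleftrightarrow> (\<exists>\<nu>. limiting_cond_prob \<rho> \<alpha> \<nu>)"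

definition sequentially_gibbs :: "(nat \<Rightarrow> (nat \<Rightarrow> real) measure) \<Rightarrow> bool" where
  "sequentially_gibbs \<rho> \<longleftrightarrow> (\<forall>\<alpha>. good_magnetisation \<rho> \<alpha>)"

section \<open>The variational problem\<close>

definition rate :: "(real \<Rightarrow> real) \<Rightarrow> real \<Rightarrow> real \<Rightarrow> real \<Rightarrow> real" where
  "rate V t \<alpha> r = V r + r\<^sup>2 / 2 + (r - \<alpha>)\<^sup>2 / (2 * t)
     - (INF s. V s + s\<^sup>2 / 2 + (s - \<alpha>)\<^sup>2 / (2 * t))"

abbreviation global_minimiser :: "(real \<Rightarrow> real) \<Rightarrow> real \<Rightarrow> bool" where
  "global_minimiser f q \<equiv> is_arg_min f (\<lambda>_. True) q"

section \<open>Consistency of the definitions\<close>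

lemma converges_weakly_iff_weak_conv_m:
  assumes "\<And>n. real_distribution (\<mu> n)" "real_distribution \<nu>"
  shows "converges_weakly \<mu> \<nu> \<longleftrightarrow> weak_conv_m \<mu> \<nu>"
proof
  assume *: "converges_weakly \<mu> \<nu>"
  show "weak_conv_m \<mu> \<nu>"
  proof (rule integral_bdd_continuous_conv_imp_weak_conv[OF assms])
    fix f :: "real \<Rightarrow> real"
    assume f: "\<And>x. isCont f x" "\<And>x. \<bar>f x\<bar> \<le> 1"
    have "bounded (range f)" using f(2) by (auto intro!: boundedI[of _ 1])
    moreover have "continuous_on UNIV f" using f(1) by (simp add: continuous_at_imp_continuous_on)
    ultimately show "(\<lambda>n. integral\<^sup>L (\<mu> n) f) \<longlonglongrightarrow> integral\<^sup>L \<nu> f"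
      using * unfolding converges_weakly_def by simp
  qed
next
  assume *: "weak_conv_m \<mu> \<nu>"
  show "converges_weakly \<mu> \<nu>"
    unfolding converges_weakly_def
  proof (intro allI impI)
    fix f :: "real \<Rightarrow> real"
    assume f: "continuous_on UNIV f \<and> bounded (range f)"
    then obtain B where "\<And>x. norm (f x) \<le> B" by (auto simp: bounded_iff)
    moreover have "\<And>x. isCont f x" using f by (simp add: continuous_on_eq_continuous_at)
    ultimately show "(\<lambda>n. \<integral>x. f x \<partial>\<mu> n) \<longlonglongrightarrow> (\<integral>x. f x \<partial>\<nu>)"
      using weak_conv_imp_integral_bdd_continuous_conv[OF assms *] by blast
  qed
qed

lemma sets_normal_distr [simp, measurable_cong]: "sets (normal_distr a v) = sets borel"
  by (simp add: normal_distr_def)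

lemma space_normal_distr [simp]: "space (normal_distr a v) = UNIV"
  by (simp add: normal_distr_def)

lemma prob_space_normal_distr: "v > 0 \<Longrightarrow> prob_space (normal_distr a v)"
  unfolding normal_distr_def by (rule prob_space_normal_density) simp

lemma sets_iso_normal_distr [simp, measurable_cong]: "sets (iso_normal_distr n z v) = sets (spins n)"
  unfolding iso_normal_distr_def by (rule sets_PiM_cong) simp_all

lemma space_iso_normal_distr [simp]: "space (iso_normal_distr n z v) = space (spins n)"
  by (rule sets_eq_imp_space_eq) simp

lemma prob_space_iso_normal_distr: "v > 0 \<Longrightarrow> prob_space (iso_normal_distr n z v)"
  unfolding iso_normal_distr_def by (rule prob_space_PiM) (rule prob_space_normal_distr)

lemma measurable_iso_normal_distr:
  assumes v: "v > 0"
  shows "(\<lambda>z. iso_normal_distr n z v) \<in> spins n \<rightarrow>\<^sub>M prob_algebra (spins n)"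
proof (rule measurable_prob_algebra_generated[where \<Omega> = "\<Pi>\<^sub>E i\<in>{..<n}. UNIV"
      and G = "{Pi\<^sub>E {..<n} E | E. \<forall>i\<in>{..<n}. E i \<in> sets borel}"])
  show "sets (spins n) =
      sigma_sets (\<Pi>\<^sub>E i\<in>{..<n}. UNIV) {Pi\<^sub>E {..<n} E | E. \<forall>i\<in>{..<n}. E i \<in> sets (borel :: real measure)}"
    unfolding sets_PiM prod_algebra_eq_finite[OF finite_lessThan] Pi_iff space_borel ..
  show "Int_stable {Pi\<^sub>E {..<n} E | E. \<forall>i\<in>{..<n}. E i \<in> sets (borel :: real measure)}"
    by (rule Int_stable_PiE)
  show "{Pi\<^sub>E {..<n} E | E. \<forall>i\<in>{..<n}. E i \<in> sets borel} \<subseteq> Pow (\<Pi>\<^sub>E i\<in>{..<n}. (UNIV :: real set))"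
    by (auto simp: PiE_iff)
next
  fix A assume "A \<in> {Pi\<^sub>E {..<n} E | E. \<forall>i\<in>{..<n}. E i \<in> sets (borel :: real measure)}"
  then obtain E where A: "A = Pi\<^sub>E {..<n} E" and E: "\<And>i. i < n \<Longrightarrow> E i \<in> sets borel" by auto
  have box: "emeasure (iso_normal_distr n z v) A = (\<Prod>i<n. emeasure (normal_distr (z i) v) (E i))" for z
  proof -
    interpret P: product_prob_space "\<lambda>i. normal_distr (z i) v" "{..<n}"
      by (rule product_prob_spaceI) (rule prob_space_normal_distr[OF v])
    show ?thesis
      unfolding iso_normal_distr_def A
      by (rule P.emeasure_PiM) (simp_all add: E)
  qed
  have one: "(\<lambda>a. emeasure (normal_distr a v) B) \<in> borel_measurable borel" if [measurable]: "B \<in> sets borel" for B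
  proof -
    have "emeasure (normal_distr a v) B = (\<integral>\<^sup>+x. ennreal (normal_density a (sqrt v) x) * indicator B x \<partial>lborel)" for a
      unfolding normal_distr_def by (subst emeasure_density) auto
    then show ?thesis
      unfolding normal_density_def by simp
  qed
  have "(\<lambda>z. \<Prod>i<n. emeasure (normal_distr (z i) v) (E i)) \<in> borel_measurable (spins n)"
  proof (rule borel_measurable_prod_ennreal)
    fix i assume "i \<in> {..<n}"
    then show "(\<lambda>z. emeasure (normal_distr (z i) v) (E i)) \<in> borel_measurable (spins n)"
      by (intro measurable_compose[OF _ one] measurable_component_singleton E) auto
  qed
  then show "(\<lambda>z. emeasure (iso_normal_distr n z v) A) \<in> borel_measurable (spins n)"
    by (simp add: box)
qed (simp_all add: prob_space_iso_normal_distr v)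

lemma borel_measurable_magnetisation [measurable]: "magnetisation n \<in> borel_measurable (spins n)"
  unfolding magnetisation_def[abs_def] by measurable

context
  fixes V :: "real \<Rightarrow> real" and n :: nat
  assumes V_measurable [measurable]: "V \<in> borel_measurable borel" and V_nonneg: "\<And>x. 0 \<le> V x"
begin

lemma integrable_boltzmann:
  "integrable (iso_normal_distr n (\<lambda>_. 0) 1) (\<lambda>z. exp (- (real n * V (magnetisation n z))))"
proof -
  interpret prob_space "iso_normal_distr n (\<lambda>_. 0) 1" by (rule prob_space_iso_normal_distr) simp
  show ?thesis
    by (rule integrable_const_bound[where B = 1]) (simp_all add: V_nonneg)
qed

lemma partition_function_pos: "partition_function V n > 0"
proof -
  interpret prob_space "iso_normal_distr n (\<lambda>_. 0) 1" by (rule prob_space_iso_normal_distr) simp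
  have "\<not> (AE z in iso_normal_distr n (\<lambda>_. 0) 1. exp (- (real n * V (magnetisation n z))) = 0)"
    by simp
  then have "partition_function V n \<noteq> 0"
    unfolding partition_function_def
    by (subst integral_nonneg_eq_0_iff_AE[OF integrable_boltzmann]) auto
  moreover have "partition_function V n \<ge> 0"
    unfolding partition_function_def by (rule integral_nonneg_AE) simp
  ultimately show ?thesis by simp
qed

lemma sets_mean_field_gibbs [simp, measurable_cong]: "sets (mean_field_gibbs V n) = sets (spins n)"
  by (simp add: mean_field_gibbs_def)

lemma prob_space_mean_field_gibbs: "prob_space (mean_field_gibbs V n)"
proof (rule prob_spaceI)
  have "emeasure (mean_field_gibbs V n) (space (mean_field_gibbs V n)) =
     (\<integral>\<^sup>+z. ennreal (exp (- (real n * V (magnetisation n z))) / partition_function V n)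
        \<partial>iso_normal_distr n (\<lambda>_. 0) 1)"
    unfolding mean_field_gibbs_def
    by (subst emeasure_density) (auto intro!: nn_integral_cong)
  also have "\<dots> = ennreal (\<integral>z. exp (- (real n * V (magnetisation n z))) / partition_function V n
        \<partial>iso_normal_distr n (\<lambda>_. 0) 1)"
    using partition_function_pos
    by (intro nn_integral_eq_integral integrable_divide integrable_boltzmann) auto
  also have "\<dots> = 1"
    using partition_function_pos by (simp add: partition_function_def)
  finally show "emeasure (mean_field_gibbs V n) (space (mean_field_gibbs V n)) = 1" .
qed

lemma
  assumes t: "t > 0"
  shows prob_space_time_evolved: "prob_space (time_evolved V t n)"
    and sets_time_evolved: "sets (time_evolved V t n) = sets (spins n)"
    and emeasure_time_evolved: "A \<in> sets (spins n) \<Longrightarrow>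
      emeasure (time_evolved V t n) A =
        ennreal (1 / partition_function V n) *
        (\<integral>\<^sup>+z. emeasure (iso_normal_distr n z t) A * ennreal (exp (- (real n * V (magnetisation n z))))
           \<partial>iso_normal_distr n (\<lambda>_. 0) 1)"
proof -
  have k: "(\<lambda>z. iso_normal_distr n z t) \<in> mean_field_gibbs V n \<rightarrow>\<^sub>M prob_algebra (spins n)"
    using measurable_iso_normal_distr[OF t] by (simp cong: measurable_cong_sets)
  have m: "mean_field_gibbs V n \<in> space (prob_algebra (mean_field_gibbs V n))"
    by (simp add: space_prob_algebra prob_space_mean_field_gibbs)
  show "prob_space (time_evolved V t n)"
    unfolding time_evolved_def by (rule prob_space_bind'[OF m k])
  show "sets (time_evolved V t n) = sets (spins n)"
    unfolding time_evolved_def by (rule sets_bind'[OF m k])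
  assume A: "A \<in> sets (spins n)"
  have [measurable]: "(\<lambda>z. emeasure (iso_normal_distr n z t) A) \<in> borel_measurable (spins n)"
    using measurable_prob_algebraD[OF measurable_iso_normal_distr[OF t]]
    by (rule measurable_emeasure_kernel) (rule A)
  have "emeasure (time_evolved V t n) A =
      (\<integral>\<^sup>+z. emeasure (iso_normal_distr n z t) A \<partial>mean_field_gibbs V n)"
    unfolding time_evolved_def
    using prob_space.not_empty[OF prob_space_mean_field_gibbs]
    by (intro emeasure_bind[OF _ measurable_prob_algebraD[OF k] A])
  also have "\<dots> = (\<integral>\<^sup>+z. ennreal (1 / partition_function V n) *
        (emeasure (iso_normal_distr n z t) A * ennreal (exp (- (real n * V (magnetisation n z)))))
           \<partial>iso_normal_distr n (\<lambda>_. 0) 1)"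
    unfolding mean_field_gibbs_def
  proof (subst nn_integral_density; (intro nn_integral_cong)?)
    fix z
    have "ennreal (exp (- (real n * V (magnetisation n z))) / partition_function V n) =
        ennreal (1 / partition_function V n) * ennreal (exp (- (real n * V (magnetisation n z))))"
      using partition_function_pos by (subst ennreal_mult[symmetric]) auto
    then show "ennreal (exp (- (real n * V (magnetisation n z))) / partition_function V n) *
          emeasure (iso_normal_distr n z t) A =
        ennreal (1 / partition_function V n) *
        (emeasure (iso_normal_distr n z t) A * ennreal (exp (- (real n * V (magnetisation n z)))))"
      by (simp add: ac_simps)
  qed measurable
  also have "\<dots> = ennreal (1 / partition_function V n) *
        (\<integral>\<^sup>+z. emeasure (iso_normal_distr n z t) A * ennreal (exp (- (real n * V (magnetisation n z))))
           \<partial>iso_normal_distr n (\<lambda>_. 0) 1)"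
    by (rule nn_integral_cmult) measurable
  finally show "emeasure (time_evolved V t n) A =
        ennreal (1 / partition_function V n) *
        (\<integral>\<^sup>+z. emeasure (iso_normal_distr n z t) A * ennreal (exp (- (real n * V (magnetisation n z))))
           \<partial>iso_normal_distr n (\<lambda>_. 0) 1)" .
qed

end

end

theory Submission
  imports Defs "HOL-Real_Asymp.Real_Asymp"
begin

text \<open>
  By the Gaussian Bayes formula \<open>time_evolved V t n\<close> has a density with respect to the centred
  normal distribution of variance \<open>1 + t\<close> that depends on the spins only through their magnetisation. Hence
  the law of the first spin given the others is a function of their magnetisation \<open>a\<close>, and a second
  application of Bayes writes it as a mixture of normal distributions with mean roughly
  \<open>((1 + t) * s - a) / t\<close>, where the hidden initial magnetisation \<open>s\<close> has a density proportional to
  \<open>exp (- n * H\<^sub>n s)\<close> and \<open>H\<^sub>n\<close> converges to the function to be minimised. If the minimiser \<open>q\<close> is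
  unique, Laplace's method makes \<open>s\<close> concentrate at \<open>q\<close> and the limiting mean is \<open>- V' q\<close>. If there
  are two minimisers, approaching \<open>\<alpha>\<close> slowly from the right makes \<open>s\<close> concentrate above every number
  below the larger one, approaching it from the left has the opposite effect at the smaller one, and the two
  limits of the mean of \<open>arctan\<close> differ.
\<close>

section \<open>Gaussian identities\<close>

text \<open>The definition of a good magnetisation quantifies over kernels and over configurations.
  Both are removed: the marginal of the other spins charges every nonempty open set, so weakly
  continuous kernels have the same integrals everywhere, and constant configurations realise every
  magnetisation. What remains is a statement about \<open>cond_kernel V t n (a n)\<close> for real
  sequences \<open>a\<close> tending to \<alpha>. With several minimisers, nothing is known about
  how the posterior at \<alpha> itself shares its mass among them, so the constant sequence need not
  reveal a failure. Replacing \<alpha> by \<beta> changes the objective, up to a constant, by a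
  linear function of \<open>s\<close> with slope \<open>(\<alpha> - \<beta>) / t\<close>; hence an
  arbitrarily small shift excludes a half-line with a uniform gap, whatever the set of minimisers
  looks like. A nonnegative \<open>V\<close> need not grow, so compactness and integrability both
  come from the quadratic terms. The limiting mean becomes \<open>- deriv V q\<close> through the
  first-order condition at \<open>q\<close>.\<close>

lemma normal_density_bayes:
  fixes k x b s :: real
  assumes v1: "0 < v1" and v2: "0 < v2"
  defines "w \<equiv> k\<^sup>2 * v1 + v2"
  shows "normal_density 0 (sqrt v1) x * normal_density (k * x + b) (sqrt v2) s =
    normal_density b (sqrt w) s * normal_density (v1 * k * (s - b) / w) (sqrt (v1 * v2 / w)) x"
proof -
  have w: "w > 0" unfolding w_def using v1 v2 by (intro add_nonneg_pos) auto
  have c: "1 / sqrt (2 * pi * (sqrt v1)\<^sup>2) * (1 / sqrt (2 * pi * (sqrt v2)\<^sup>2)) =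
     1 / sqrt (2 * pi * (sqrt w)\<^sup>2) * (1 / sqrt (2 * pi * (sqrt (v1 * v2 / w))\<^sup>2))"
    using v1 v2 w by (simp add: real_sqrt_mult real_sqrt_divide)
  have e: "- (x\<^sup>2 / (2 * v1)) - (s - (k * x + b))\<^sup>2 / (2 * v2) =
     - ((s - b)\<^sup>2 / (2 * w)) - (x - v1 * k * (s - b) / w)\<^sup>2 / (2 * (v1 * v2 / w))"
  proof -
    define d where "d = s - b"
    have "(d - k * x)\<^sup>2 / (2 * v2) + x\<^sup>2 / (2 * v1) = d\<^sup>2 / (2 * w) + (x - v1 * k * d / w)\<^sup>2 / (2 * (v1 * v2 / w))"
    proof -
      have "(x - v1 * k * d / w)\<^sup>2 / (2 * (v1 * v2 / w)) = (w * x - v1 * k * d)\<^sup>2 / (2 * v1 * v2 * w)"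
        using v1 v2 w by (simp add: field_simps power2_eq_square)
      also have "d\<^sup>2 / (2 * w) + \<dots> = (v1 * v2 * d\<^sup>2 + (w * x - v1 * k * d)\<^sup>2) / (2 * v1 * v2 * w)"
        using v1 v2 w by (simp add: field_simps)
      \<comment> \<open>The completed square with denominators cleared; it rests on
        \<open>w = k\<^sup>2 * v1 + v2\<close>.\<close>
      also have "v1 * v2 * d\<^sup>2 + (w * x - v1 * k * d)\<^sup>2 = w * (v1 * (d - k * x)\<^sup>2 + v2 * x\<^sup>2)"
        unfolding w_def by (simp add: power2_eq_square algebra_simps)
      also have "\<dots> / (2 * v1 * v2 * w) = (d - k * x)\<^sup>2 / (2 * v2) + x\<^sup>2 / (2 * v1)"
        using v1 v2 w by (simp add: field_simps)
      finally show ?thesis by simp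
    qed
    then show ?thesis by (simp add: d_def algebra_simps)
  qed
  have nd: "normal_density m (sqrt v) y = 1 / sqrt (2 * pi * (sqrt v)\<^sup>2) * exp (- ((y - m)\<^sup>2 / (2 * v)))"
    if "0 < v" for m v y :: real
    using that by (simp add: normal_density_def)
  have ex: "c * exp (- A) * (d * exp (- B)) = c * d * exp (- A - B)" for c d A B :: real
    by (simp add: exp_diff exp_minus field_simps)
  have w': "0 < v1 * v2 / w" using v1 v2 w by simp
  show ?thesis
    unfolding nd[OF v1] nd[OF v2] nd[OF w] nd[OF w'] ex c diff_0_right e ..
qed

section \<open>Gaussian vectors and their magnetisation\<close>

abbreviation lebesgue_spins :: "nat \<Rightarrow> (nat \<Rightarrow> real) measure" where
  "lebesgue_spins n \<equiv> \<Pi>\<^sub>M i\<in>{..<n}. lborel"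

lemma sets_lebesgue_spins [simp, measurable_cong]: "sets (lebesgue_spins n) = sets (spins n)"
  by (rule sets_PiM_cong) simp_all

lemma sigma_finite_lebesgue_spins: "sigma_finite_measure (lebesgue_spins n)"
proof -
  interpret L: finite_product_sigma_finite "\<lambda>_. lborel :: real measure" "{..<n}"
    by standard auto
  show ?thesis by (rule L.sigma_finite_measure_axioms)
qed

text \<open>Boxes determine a product measure, and on a box the integral of a product of densities
  factorises. A reference measure that does not depend on the mean \<open>z\<close> is what later
  permits exchanging the integrals over initial and evolved spins.\<close>

lemma iso_normal_distr_eq_density:
  assumes v: "0 < v"
  shows "iso_normal_distr n z v =
    density (lebesgue_spins n) (\<lambda>x. ennreal (\<Prod>i<n. normal_density (z i) (sqrt v) (x i)))"
proof -
  interpret P: product_prob_space "\<lambda>i. normal_distr (z i) v" "{..<n}"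
    by (rule product_prob_spaceI) (rule prob_space_normal_distr[OF v])
  interpret L: product_sigma_finite "\<lambda>_::nat. lborel :: real measure"
    by standard
  show ?thesis unfolding iso_normal_distr_def
  proof (rule P.PiM_eqI[symmetric])
    show "sets (density (lebesgue_spins n) (\<lambda>x. ennreal (\<Prod>i<n. normal_density (z i) (sqrt v) (x i)))) =
        sets (\<Pi>\<^sub>M i\<in>{..<n}. normal_distr (z i) v)"
      using sets_iso_normal_distr[of n z v] by (simp add: iso_normal_distr_def)
  next
    fix A assume A: "\<And>i. i \<in> {..<n} \<Longrightarrow> A i \<in> sets (normal_distr (z i) v)"
    then have [measurable]: "i < n \<Longrightarrow> A i \<in> sets borel" for i by simp
    have AA: "Pi\<^sub>E {..<n} A \<in> sets (lebesgue_spins n)"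
      unfolding sets_lebesgue_spins by (rule sets_PiM_I_finite) auto
    have "emeasure (density (lebesgue_spins n) (\<lambda>x. ennreal (\<Prod>i<n. normal_density (z i) (sqrt v) (x i)))) (Pi\<^sub>E {..<n} A) =
      (\<integral>\<^sup>+x. ennreal (\<Prod>i<n. normal_density (z i) (sqrt v) (x i)) * indicator (Pi\<^sub>E {..<n} A) x \<partial>lebesgue_spins n)"
      using AA by (intro emeasure_density) simp_all
    also have "\<dots> = (\<integral>\<^sup>+x. (\<Prod>i<n. ennreal (normal_density (z i) (sqrt v) (x i)) * indicator (A i) (x i)) \<partial>lebesgue_spins n)"
    proof (rule nn_integral_cong)
      fix x assume x: "x \<in> space (lebesgue_spins n)"
      have "indicator (Pi\<^sub>E {..<n} A) x = (\<Prod>i<n. indicator (A i) (x i) :: ennreal)"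
      proof (cases "x \<in> Pi\<^sub>E {..<n} A")
        case False
        then obtain i where "i < n" "x i \<notin> A i" using x by (auto simp: space_PiM PiE_iff)
        then have "(\<Prod>i<n. indicator (A i) (x i) :: ennreal) = 0" by (intro prod_zero bexI[of _ i]) auto
        then show ?thesis using False by simp
      qed (auto simp: PiE_iff)
      then show "ennreal (\<Prod>i<n. normal_density (z i) (sqrt v) (x i)) * indicator (Pi\<^sub>E {..<n} A) x =
         (\<Prod>i<n. ennreal (normal_density (z i) (sqrt v) (x i)) * indicator (A i) (x i))"
        by (simp add: prod.distrib prod_ennreal)
    qed
    also have "\<dots> = (\<Prod>i<n. \<integral>\<^sup>+x. ennreal (normal_density (z i) (sqrt v) x) * indicator (A i) x \<partial>lborel)"
      by (rule L.product_nn_integral_prod) auto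
    also have "\<dots> = (\<Prod>i<n. emeasure (normal_distr (z i) v) (A i))"
      by (intro prod.cong) (auto simp: normal_distr_def emeasure_density)
    finally show "emeasure (density (lebesgue_spins n) (\<lambda>x. ennreal (\<Prod>i<n. normal_density (z i) (sqrt v) (x i)))) (Pi\<^sub>E {..<n} A) =
        (\<Prod>i<n. emeasure (normal_distr (z i) v) (A i))" .
  qed simp
qed

lemma magnetisation_distr:
  assumes v: "0 < v" and n: "0 < n"
  shows "distr (iso_normal_distr n z v) borel (magnetisation n) = normal_distr (magnetisation n z) (v / real n)"
proof -
  let ?P = "iso_normal_distr n z v"
  interpret P: product_prob_space "\<lambda>i. normal_distr (z i) v" "{..<n}"
    by (rule product_prob_spaceI) (rule prob_space_normal_distr[OF v])
  interpret I: prob_space ?P by (rule prob_space_iso_normal_distr[OF v])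
  have comp: "distr ?P borel (\<lambda>x. x i) = normal_distr (z i) v" if "i < n" for i
  proof -
    have "distr ?P (normal_distr (z i) v) (\<lambda>x. x i) = normal_distr (z i) v"
      unfolding iso_normal_distr_def using that by (intro P.PiM_component) auto
    moreover have "distr ?P borel (\<lambda>x. x i) = distr ?P (normal_distr (z i) v) (\<lambda>x. x i)"
      by (rule distr_cong) auto
    ultimately show ?thesis by simp
  qed
  \<comment> \<open>Independence is the equality of the joint law with the product of the marginals.
    The joint law is \<open>?P\<close> itself, because restriction to \<open>{..<n}\<close> is the
    identity on its carrier.\<close>
  have ind: "I.indep_vars (\<lambda>_. borel) (\<lambda>i x. x i) {..<n}"
  proof (subst I.indep_vars_iff_distr_eq_PiM')
    show "{..<n} \<noteq> {}" using n by auto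
    show "(\<lambda>x. x i) \<in> borel_measurable ?P" if "i \<in> {..<n}" for i using that by measurable
    have "distr ?P (spins n) (\<lambda>x. \<lambda>i\<in>{..<n}. x i) = distr ?P ?P (\<lambda>x. x)"
      by (rule distr_cong) (auto simp: space_PiM PiE_iff extensional_def restrict_def fun_eq_iff)
    also have "\<dots> = ?P" by (rule distr_id)
    also have "\<dots> = (\<Pi>\<^sub>M i\<in>{..<n}. distr ?P borel (\<lambda>x. x i))"
      unfolding iso_normal_distr_def[of n z v]
      by (rule PiM_cong) (use comp in \<open>auto simp: iso_normal_distr_def\<close>)
    finally show "distr ?P (spins n) (\<lambda>x. \<lambda>i\<in>{..<n}. x i) = (\<Pi>\<^sub>M i\<in>{..<n}. distr ?P borel (\<lambda>x. x i))" .
  qed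
  have "distributed ?P lborel (\<lambda>x. \<Sum>i<n. x i) (normal_density (\<Sum>i<n. z i) (sqrt (\<Sum>i<n. (sqrt v)\<^sup>2)))"
  proof (rule I.sum_indep_normal[OF _ _ ind])
    show "distributed ?P lborel (\<lambda>x. x i) (normal_density (z i) (sqrt v))" if "i \<in> {..<n}" for i
    proof -
      have "distr ?P lborel (\<lambda>x. x i) = distr ?P borel (\<lambda>x. x i)" by (rule distr_cong) auto
      then show ?thesis
        unfolding distributed_def using comp[of i] that by (auto simp: normal_distr_def)
    qed
  qed (use n v in auto)
  from I.normal_density_affine[OF this, of "1 / real n" 0]
  have "distributed ?P lborel (\<lambda>x. (\<Sum>i<n. x i) / real n)
      (normal_density ((\<Sum>i<n. z i) / real n) (1 / real n * sqrt (real n * v)))"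
    using n v by simp
  also have "1 / real n * sqrt (real n * v) = sqrt (v / real n)"
    using n v by (simp add: real_sqrt_mult real_sqrt_divide field_simps)
  finally have "distr ?P lborel (magnetisation n) = normal_distr (magnetisation n z) (v / real n)"
    by (simp add: distributed_def normal_distr_def magnetisation_def[abs_def])
  moreover have "distr ?P borel (magnetisation n) = distr ?P lborel (magnetisation n)"
    by (rule distr_cong) auto
  ultimately show ?thesis by simp
qed

text \<open>Given evolved spins \<open>x\<close>, the initial spins are independent normal with
  means \<open>x i / (1 + t)\<close> and variance \<open>t / (1 + t)\<close>. So this is the
  conditional expectation of the Boltzmann factor under the Gaussian reference law, given that the
  evolved magnetisation is \<open>b\<close>.\<close>

definition tilt :: "(real \<Rightarrow> real) \<Rightarrow> real \<Rightarrow> nat \<Rightarrow> real \<Rightarrow> real" where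
  "tilt V t n b = (\<integral>s. exp (- (real n * V s)) \<partial>normal_distr (b / (1 + t)) (t / ((1 + t) * real n)))"

lemma nn_integral_normal_distr:
  assumes [measurable]: "f \<in> borel_measurable borel"
  shows "(\<integral>\<^sup>+x. f x \<partial>normal_distr a v) = (\<integral>\<^sup>+x. ennreal (normal_density a (sqrt v) x) * f x \<partial>lborel)"
  unfolding normal_distr_def by (subst nn_integral_density) auto

text \<open>Moves mean and variance from the measure into the integrand, so that dependence on
  parameters can be handled by dominated convergence under one fixed measure.\<close>

lemma integral_normal_distr_standardise:
  fixes f :: "real \<Rightarrow> real"
  assumes v: "0 < v" and [measurable]: "f \<in> borel_measurable borel"
  shows "(\<integral>x. f x \<partial>normal_distr a v) = (\<integral>x. f (a + sqrt v * x) \<partial>std_normal_distribution)"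
proof -
  have "distributed std_normal_distribution lborel (\<lambda>x. x) std_normal_density"
    unfolding distributed_def by (auto intro!: measure_eqI simp: emeasure_distr)
  then have "distributed std_normal_distribution lborel (\<lambda>x. a + sqrt v * x) (normal_density (a + sqrt v * 0) (\<bar>sqrt v\<bar> * 1))"
    by (intro prob_space.normal_density_affine prob_space_normal_density) (use v in auto)
  then have "distr std_normal_distribution lborel (\<lambda>x. a + sqrt v * x) = normal_distr a v"
    using v by (simp add: distributed_def normal_distr_def)
  then have "(\<integral>x. f x \<partial>normal_distr a v) = (\<integral>x. f x \<partial>distr std_normal_distribution lborel (\<lambda>x. a + sqrt v * x))"
    by simp
  also have "\<dots> = (\<integral>x. f (a + sqrt v * x) \<partial>std_normal_distribution)"
    by (rule integral_distr) auto
  finally show ?thesis .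
qed

section \<open>Density of the time-evolved measure\<close>

context
  fixes V :: "real \<Rightarrow> real"
  assumes V_measurable [measurable]: "V \<in> borel_measurable borel" and V_nonneg: "\<And>x. 0 \<le> V x"
begin

lemma integrable_exp_potential:
  assumes "prob_space M" "sets M = sets borel"
  shows "integrable M (\<lambda>s. exp (- (real n * V s)))"
proof -
  interpret prob_space M by fact
  have [measurable_cong]: "sets M = sets borel" by fact
  show ?thesis
    by (rule integrable_const_bound[where B = 1]) (auto simp: V_nonneg)
qed

lemma nn_integral_iso_normal_exp_potential:
  assumes v: "0 < v" and n: "0 < n"
  shows "(\<integral>\<^sup>+z. ennreal (exp (- (real n * V (magnetisation n z)))) \<partial>iso_normal_distr n w v) =
    ennreal (\<integral>s. exp (- (real n * V s)) \<partial>normal_distr (magnetisation n w) (v / real n))"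
proof -
  have "(\<integral>\<^sup>+z. ennreal (exp (- (real n * V (magnetisation n z)))) \<partial>iso_normal_distr n w v) =
    (\<integral>\<^sup>+s. ennreal (exp (- (real n * V s))) \<partial>distr (iso_normal_distr n w v) borel (magnetisation n))"
    by (subst nn_integral_distr) auto
  also have "\<dots> = ennreal (\<integral>s. exp (- (real n * V s)) \<partial>normal_distr (magnetisation n w) (v / real n))"
    unfolding magnetisation_distr[OF v n]
    using v n by (intro nn_integral_eq_integral integrable_exp_potential prob_space_normal_distr) auto
  finally show ?thesis .
qed

text \<open>Applying \<open>normal_density_bayes\<close> to each coordinate swaps the roles of
  initial spins \<open>z\<close> and evolved spins \<open>x\<close>. After exchanging the integrals,
  the inner one averages the Boltzmann factor over \<open>z\<close> given \<open>x\<close>, and this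
  factor sees \<open>z\<close> only through its magnetisation.\<close>

lemma time_evolved_eq_density:
  assumes t: "0 < t" and n: "0 < n"
  shows "time_evolved V t n = density (iso_normal_distr n (\<lambda>_. 0) (1 + t))
    (\<lambda>x. ennreal (1 / partition_function V n) * ennreal (tilt V t n (magnetisation n x)))"
    (is "_ = density ?I ?D")
proof (rule measure_eqI)
  show "sets (time_evolved V t n) = sets (density ?I ?D)"
    using sets_time_evolved[OF V_measurable V_nonneg t] by simp
next
  fix A assume "A \<in> sets (time_evolved V t n)"
  then have A[measurable]: "A \<in> sets (spins n)"
    using sets_time_evolved[OF V_measurable V_nonneg t] by simp
  let ?L = "lebesgue_spins n"
  let ?h = "\<lambda>z. ennreal (exp (- (real n * V (magnetisation n z))))"
  let ?p = "\<lambda>z v x. ennreal (\<Prod>i<n. normal_density (z i) (sqrt v) (x i))"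
  interpret L: sigma_finite_measure ?L by (rule sigma_finite_lebesgue_spins)
  interpret LL: pair_sigma_finite ?L ?L ..
  have t1: "0 < 1 + t" "0 < t / (1 + t)" using t by auto
  have bayes: "?p (\<lambda>_. 0) 1 z * ?p z t x = ?p (\<lambda>_. 0) (1 + t) x * ?p (\<lambda>i. x i / (1 + t)) (t / (1 + t)) z" for x z
  proof -
    have "(\<Prod>i<n. normal_density 0 1 (z i)) * (\<Prod>i<n. normal_density (z i) (sqrt t) (x i)) =
      (\<Prod>i<n. normal_density 0 (sqrt (1 + t)) (x i)) * (\<Prod>i<n. normal_density (x i / (1 + t)) (sqrt (t / (1 + t))) (z i))"
      unfolding prod.distrib[symmetric]
    proof (rule prod.cong[OF refl])
      fix i
      show "normal_density 0 1 (z i) * normal_density (z i) (sqrt t) (x i) =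
        normal_density 0 (sqrt (1 + t)) (x i) * normal_density (x i / (1 + t)) (sqrt (t / (1 + t))) (z i)"
        using normal_density_bayes[of 1 t "z i" 1 0 "x i"] t by simp
    qed
    then show ?thesis
      by (simp flip: ennreal_mult' add: prod_nonneg)
  qed
  have [measurable]: "(\<lambda>(x, z). ?p z t x) \<in> borel_measurable (?L \<Otimes>\<^sub>M ?L)"
    unfolding normal_density_def by measurable
  have [measurable]: "(\<lambda>(x, z). ?p (\<lambda>i. x i / (1 + t)) (t / (1 + t)) z) \<in> borel_measurable (?L \<Otimes>\<^sub>M ?L)"
    unfolding normal_density_def by measurable
  have [measurable]: "?h \<in> borel_measurable (spins n)" by measurable
  have em: "emeasure (iso_normal_distr n z t) A = (\<integral>\<^sup>+x. ?p z t x * indicator A x \<partial>?L)" for z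
    unfolding iso_normal_distr_eq_density[OF t] by (rule emeasure_density) auto
  have tl: "(\<integral>\<^sup>+z. ?p (\<lambda>i. x i / (1 + t)) (t / (1 + t)) z * ?h z \<partial>?L) = ennreal (tilt V t n (magnetisation n x))" for x
  proof -
    have "(\<integral>\<^sup>+z. ?p (\<lambda>i. x i / (1 + t)) (t / (1 + t)) z * ?h z \<partial>?L) =
      (\<integral>\<^sup>+z. ?h z \<partial>iso_normal_distr n (\<lambda>i. x i / (1 + t)) (t / (1 + t)))"
      unfolding iso_normal_distr_eq_density[OF t1(2)] by (subst nn_integral_density) auto
    also have "\<dots> = ennreal (tilt V t n (magnetisation n x))"
      unfolding nn_integral_iso_normal_exp_potential[OF t1(2) n] tilt_def
      by (simp add: magnetisation_def sum_divide_distrib mult.commute)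
    finally show ?thesis .
  qed
  have tilt_m[measurable]: "(\<lambda>x. ennreal (tilt V t n (magnetisation n x))) \<in> borel_measurable (spins n)"
    unfolding tl[symmetric] by measurable
  have "(\<integral>\<^sup>+z. emeasure (iso_normal_distr n z t) A * ?h z \<partial>iso_normal_distr n (\<lambda>_. 0) 1) =
    (\<integral>\<^sup>+z. ?p (\<lambda>_. 0) 1 z * ((\<integral>\<^sup>+x. ?p z t x * indicator A x \<partial>?L) * ?h z) \<partial>?L)"
    unfolding em iso_normal_distr_eq_density[OF zero_less_one]
    by (subst nn_integral_density) auto
  also have "\<dots> = (\<integral>\<^sup>+z. \<integral>\<^sup>+x. (?p (\<lambda>_. 0) 1 z * ?p z t x) * indicator A x * ?h z \<partial>?L \<partial>?L)"
    by (intro nn_integral_cong)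
      (auto simp: nn_integral_cmult[symmetric] nn_integral_multc[symmetric] ac_simps)
  also have "\<dots> = (\<integral>\<^sup>+z. \<integral>\<^sup>+x. (?p (\<lambda>_. 0) (1 + t) x * ?p (\<lambda>i. x i / (1 + t)) (t / (1 + t)) z) * indicator A x * ?h z \<partial>?L \<partial>?L)"
    unfolding bayes ..
  also have "\<dots> = (\<integral>\<^sup>+x. \<integral>\<^sup>+z. (?p (\<lambda>_. 0) (1 + t) x * ?p (\<lambda>i. x i / (1 + t)) (t / (1 + t)) z) * indicator A x * ?h z \<partial>?L \<partial>?L)"
    by (rule LL.Fubini') measurable
  also have "\<dots> = (\<integral>\<^sup>+x. ?p (\<lambda>_. 0) (1 + t) x * (ennreal (tilt V t n (magnetisation n x)) * indicator A x) \<partial>?L)"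
  proof (rule nn_integral_cong)
    fix x assume [measurable]: "x \<in> space ?L"
    have "(\<integral>\<^sup>+z. (?p (\<lambda>_. 0) (1 + t) x * ?p (\<lambda>i. x i / (1 + t)) (t / (1 + t)) z) * indicator A x * ?h z \<partial>?L) =
      (\<integral>\<^sup>+z. (?p (\<lambda>_. 0) (1 + t) x * indicator A x) * (?p (\<lambda>i. x i / (1 + t)) (t / (1 + t)) z * ?h z) \<partial>?L)"
      by (simp only: ac_simps)
    also have "\<dots> = (?p (\<lambda>_. 0) (1 + t) x * indicator A x) * (\<integral>\<^sup>+z. ?p (\<lambda>i. x i / (1 + t)) (t / (1 + t)) z * ?h z \<partial>?L)"
      by (rule nn_integral_cmult) measurable
    finally show "(\<integral>\<^sup>+z. (?p (\<lambda>_. 0) (1 + t) x * ?p (\<lambda>i. x i / (1 + t)) (t / (1 + t)) z) * indicator A x * ?h z \<partial>?L) =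
      ?p (\<lambda>_. 0) (1 + t) x * (ennreal (tilt V t n (magnetisation n x)) * indicator A x)"
      unfolding tl by (simp only: ac_simps)
  qed
  also have "\<dots> = (\<integral>\<^sup>+x. ennreal (tilt V t n (magnetisation n x)) * indicator A x \<partial>?I)"
    unfolding iso_normal_distr_eq_density[OF t1(1)] by (subst nn_integral_density) auto
  finally show "emeasure (time_evolved V t n) A = emeasure (density ?I ?D) A"
    unfolding emeasure_time_evolved[OF V_measurable V_nonneg t A]
    by (simp add: emeasure_density nn_integral_cmult mult.assoc)
qed

end

section \<open>The law of the first spin given the others\<close>

text \<open>Here \<open>m\<close> counts the remaining spins. The restriction puts the result into
  the carrier of \<open>spins (Suc m)\<close>, and the shift of indices undoes the one in
  \<open>drop_first\<close>.\<close>

definition cons_spin :: "nat \<Rightarrow> real \<Rightarrow> (nat \<Rightarrow> real) \<Rightarrow> (nat \<Rightarrow> real)" where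
  "cons_spin m x y = (\<lambda>i\<in>{..<Suc m}. case i of 0 \<Rightarrow> x | Suc j \<Rightarrow> y j)"

lemma cons_spin_0 [simp]: "cons_spin m x y 0 = x"
  by (simp add: cons_spin_def)

lemma drop_first_cons_spin:
  "y \<in> space (spins m) \<Longrightarrow> drop_first (Suc m) (cons_spin m x y) = y"
  by (auto simp: drop_first_def cons_spin_def space_PiM PiE_iff extensional_def fun_eq_iff)

lemma magnetisation_cons_spin:
  "magnetisation (Suc m) (cons_spin m x y) = (x + real m * magnetisation m y) / real (Suc m)"
proof -
  have "(\<Sum>i<Suc m. cons_spin m x y i) = x + (\<Sum>j<m. y j)"
    unfolding sum.lessThan_Suc_shift by (simp add: cons_spin_def)
  \<comment> \<open>Without remaining spins the magnetisation divides by zero; the sum is then empty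
    and the factor \<open>real m\<close> vanishes, so the identity persists.\<close>
  also have "(\<Sum>j<m. y j) = real m * magnetisation m y"
    by (cases "m = 0") (simp_all add: magnetisation_def)
  finally show ?thesis by (simp add: magnetisation_def[of "Suc m"])
qed

lemma measurable_cons_spin [measurable]:
  "(\<lambda>(x, y). cons_spin m x y) \<in> borel \<Otimes>\<^sub>M spins m \<rightarrow>\<^sub>M spins (Suc m)"
  unfolding cons_spin_def case_prod_beta
proof (rule measurable_restrict)
  fix i assume "i \<in> {..<Suc m}"
  then show "(\<lambda>p. case i of 0 \<Rightarrow> fst p | Suc j \<Rightarrow> snd p j) \<in> borel_measurable (borel \<Otimes>\<^sub>M spins m)"
    by (cases i) auto
qed

lemma measurable_drop_first [measurable]: "drop_first n \<in> spins n \<rightarrow>\<^sub>M spins (n - 1)"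
  unfolding drop_first_def by (rule measurable_restrict) auto

lemma distr_cons_spin:
  assumes v: "0 < v"
  shows "distr (normal_distr 0 v \<Otimes>\<^sub>M iso_normal_distr m (\<lambda>_. 0) v) (spins (Suc m)) (\<lambda>(x, y). cons_spin m x y)
    = iso_normal_distr (Suc m) (\<lambda>_. 0) v"
proof -
  interpret P: product_prob_space "\<lambda>i. normal_distr 0 v" "{..<m}"
    by (rule product_prob_spaceI) (rule prob_space_normal_distr[OF v])
  interpret I: prob_space "iso_normal_distr m (\<lambda>_. 0) v" by (rule prob_space_iso_normal_distr[OF v])
  show ?thesis unfolding iso_normal_distr_def[of "Suc m"]
  proof (rule P.PiM_eqI)
    show "sets (distr (normal_distr 0 v \<Otimes>\<^sub>M iso_normal_distr m (\<lambda>_. 0) v) (spins (Suc m)) (\<lambda>(x, y). cons_spin m x y))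
      = sets (\<Pi>\<^sub>M i\<in>{..<Suc m}. normal_distr 0 v)"
      using sets_iso_normal_distr[of "Suc m" "\<lambda>_. 0" v] by (simp add: iso_normal_distr_def)
  next
    fix A assume "\<And>i. i \<in> {..<Suc m} \<Longrightarrow> A i \<in> sets (normal_distr 0 v)"
    then have [measurable]: "i < Suc m \<Longrightarrow> A i \<in> sets borel" for i by simp
    have [measurable]: "A 0 \<in> sets borel" by simp
    have S: "Pi\<^sub>E {..<Suc m} A \<in> sets (spins (Suc m))"
      by (rule sets_PiM_I_finite) auto
    have T: "Pi\<^sub>E {..<m} (\<lambda>i. A (Suc i)) \<in> sets (spins m)"
      by (rule sets_PiM_I_finite) auto
    have cons_iff: "cons_spin m x y \<in> Pi\<^sub>E {..<Suc m} A \<longleftrightarrow> x \<in> A 0 \<and> (\<forall>j<m. y j \<in> A (Suc j))" for x y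
    proof -
      have "cons_spin m x y \<in> Pi\<^sub>E {..<Suc m} A \<longleftrightarrow> (\<forall>i<Suc m. (case i of 0 \<Rightarrow> x | Suc j \<Rightarrow> y j) \<in> A i)"
        by (auto simp: cons_spin_def PiE_iff)
      then show ?thesis by (simp add: All_less_Suc2)
    qed
    have "(\<lambda>(x, y). cons_spin m x y) -` Pi\<^sub>E {..<Suc m} A \<inter>
        space (normal_distr 0 v \<Otimes>\<^sub>M iso_normal_distr m (\<lambda>_. 0) v) = A 0 \<times> Pi\<^sub>E {..<m} (\<lambda>i. A (Suc i))"
      by (auto simp: space_pair_measure space_PiM cons_iff)
    then have "emeasure (distr (normal_distr 0 v \<Otimes>\<^sub>M iso_normal_distr m (\<lambda>_. 0) v) (spins (Suc m)) (\<lambda>(x, y). cons_spin m x y)) (Pi\<^sub>E {..<Suc m} A)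
      = emeasure (normal_distr 0 v \<Otimes>\<^sub>M iso_normal_distr m (\<lambda>_. 0) v) (A 0 \<times> Pi\<^sub>E {..<m} (\<lambda>i. A (Suc i)))"
      using S by (subst emeasure_distr) auto
    also have "\<dots> = emeasure (normal_distr 0 v) (A 0) * emeasure (iso_normal_distr m (\<lambda>_. 0) v) (Pi\<^sub>E {..<m} (\<lambda>i. A (Suc i)))"
      using T by (intro I.emeasure_pair_measure_Times) auto
    also have "\<dots> = emeasure (normal_distr 0 v) (A 0) * (\<Prod>i<m. emeasure (normal_distr 0 v) (A (Suc i)))"
      unfolding iso_normal_distr_def by (subst P.emeasure_PiM) auto
    also have "\<dots> = (\<Prod>i<Suc m. emeasure (normal_distr 0 v) (A i))"
      unfolding prod.lessThan_Suc_shift by simp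
    finally show "emeasure (distr (normal_distr 0 v \<Otimes>\<^sub>M iso_normal_distr m (\<lambda>_. 0) v) (spins (Suc m)) (\<lambda>(x, y). cons_spin m x y)) (Pi\<^sub>E {..<Suc m} A)
      = (\<Prod>i<Suc m. emeasure (normal_distr 0 v) (A i))" .
  qed simp
qed

lemma nn_integral_iso_normal_distr_Suc:
  assumes v: "0 < v" and [measurable]: "f \<in> borel_measurable (spins (Suc m))"
  shows "(\<integral>\<^sup>+x. f x \<partial>iso_normal_distr (Suc m) (\<lambda>_. 0) v) =
    (\<integral>\<^sup>+y. \<integral>\<^sup>+x. f (cons_spin m x y) \<partial>normal_distr 0 v \<partial>iso_normal_distr m (\<lambda>_. 0) v)"
proof -
  interpret N: prob_space "normal_distr 0 v" by (rule prob_space_normal_distr[OF v])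
  interpret I: prob_space "iso_normal_distr m (\<lambda>_. 0) v" by (rule prob_space_iso_normal_distr[OF v])
  interpret NI: pair_sigma_finite "normal_distr 0 v" "iso_normal_distr m (\<lambda>_. 0) v" ..
  have "(\<integral>\<^sup>+x. f x \<partial>iso_normal_distr (Suc m) (\<lambda>_. 0) v) =
    (\<integral>\<^sup>+p. f (case p of (x, y) \<Rightarrow> cons_spin m x y) \<partial>(normal_distr 0 v \<Otimes>\<^sub>M iso_normal_distr m (\<lambda>_. 0) v))"
    unfolding distr_cons_spin[OF v, symmetric] by (subst nn_integral_distr) auto
  also have "\<dots> = (\<integral>\<^sup>+y. \<integral>\<^sup>+x. f (cons_spin m x y) \<partial>normal_distr 0 v \<partial>iso_normal_distr m (\<lambda>_. 0) v)"
    by (subst NI.nn_integral_snd[symmetric]) auto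
  finally show ?thesis .
qed

text \<open>\<open>n\<close> counts all spins and \<open>a\<close> is the magnetisation of the other
  \<open>n - 1\<close>, so \<open>tilt\<close> is evaluated at the magnetisation of the whole
  configuration. The partition function is left out because it cancels on normalising in
  \<open>cond_kernel\<close>.\<close>

definition tilted_integral :: "(real \<Rightarrow> real) \<Rightarrow> real \<Rightarrow> nat \<Rightarrow> real \<Rightarrow> (real \<Rightarrow> real) \<Rightarrow> real" where
  "tilted_integral V t n a f =
     (\<integral>x. f x * tilt V t n ((x + (real n - 1) * a) / real n) \<partial>normal_distr 0 (1 + t))"

definition cond_kernel :: "(real \<Rightarrow> real) \<Rightarrow> real \<Rightarrow> nat \<Rightarrow> real \<Rightarrow> real measure" where
  "cond_kernel V t n a = density (normal_distr 0 (1 + t))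
     (\<lambda>x. ennreal (tilt V t n ((x + (real n - 1) * a) / real n) / tilted_integral V t n a (\<lambda>_. 1)))"

lemma (in prob_space) integral_pos:
  fixes f :: "'a \<Rightarrow> real"
  assumes "integrable M f" "\<And>x. 0 < f x"
  shows "0 < integral\<^sup>L M f"
proof -
  have "\<not> (AE x in M. f x = 0)"
    using assms(2) by (simp add: less_imp_neq[THEN not_sym])
  then have "integral\<^sup>L M f \<noteq> 0"
    using assms by (subst integral_nonneg_eq_0_iff_AE) (auto intro: less_imp_le)
  moreover have "0 \<le> integral\<^sup>L M f"
    using assms by (intro integral_nonneg_AE) (auto intro: less_imp_le)
  ultimately show ?thesis by simp
qed

section \<open>Continuity and positivity of the conditional weights\<close>

locale mean_field =
  fixes V :: "real \<Rightarrow> real" and t :: real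
  assumes V_continuous: "continuous_on UNIV V" and V_nonneg: "\<And>x. 0 \<le> V x" and t_pos: "0 < t"
begin

lemma V_measurable [measurable]: "V \<in> borel_measurable borel"
  using V_continuous by (rule borel_measurable_continuous_onI)

lemma tendsto_V [tendsto_intros]: "(f \<longlongrightarrow> l) F \<Longrightarrow> ((\<lambda>x. V (f x)) \<longlongrightarrow> V l) F"
  using V_continuous by (auto intro: continuous_on_tendsto_compose)

lemma one_plus_t_pos: "0 < 1 + t" using t_pos by simp

lemma tilt_variance_pos: "0 < n \<Longrightarrow> 0 < t / ((1 + t) * real n)" using t_pos by simp

lemma prob_space_tilt: "0 < n \<Longrightarrow> prob_space (normal_distr a (t / ((1 + t) * real n)))"
  by (intro prob_space_normal_distr tilt_variance_pos)

sublocale N: prob_space "normal_distr 0 (1 + t)"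
  by (intro prob_space_normal_distr one_plus_t_pos)

sublocale std: prob_space std_normal_distribution
  by (rule prob_space_normal_density) simp

lemma tilt_pos: "0 < n \<Longrightarrow> 0 < tilt V t n b"
  unfolding tilt_def
  by (intro prob_space.integral_pos prob_space_tilt integrable_exp_potential) (auto simp: V_nonneg)

lemma tilt_le_1: "0 < n \<Longrightarrow> tilt V t n b \<le> 1"
  unfolding tilt_def
  by (intro prob_space.integral_le_const prob_space_tilt integrable_exp_potential) (auto simp: V_nonneg)

text \<open>After standardisation the parameter occurs only inside the continuous \<open>V\<close>,
  and nonnegativity of \<open>V\<close> provides the dominating function 1.\<close>

lemma tendsto_tilt [tendsto_intros]:
  assumes n: "0 < n" and b: "b \<longlonglongrightarrow> c"
  shows "(\<lambda>k. tilt V t n (b k)) \<longlonglongrightarrow> tilt V t n c"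
  unfolding tilt_def integral_normal_distr_standardise[OF tilt_variance_pos[OF n], of "\<lambda>s. exp (- (real n * V s))", simplified]
proof (rule integral_dominated_convergence[where w = "\<lambda>_. 1"])
  show "AE x in std_normal_distribution. (\<lambda>k. exp (- (real n * V (b k / (1 + t) + sqrt (t / ((1 + t) * real n)) * x))))
    \<longlonglongrightarrow> exp (- (real n * V (c / (1 + t) + sqrt (t / ((1 + t) * real n)) * x)))"
    using t_pos by (intro AE_I2 tendsto_intros b) auto
qed (auto simp: V_nonneg)

lemma continuous_tilt: "0 < n \<Longrightarrow> continuous_on UNIV (tilt V t n)"
  by (auto simp: continuous_on_sequentially comp_def intro: tendsto_tilt)

lemma measurable_tilt [measurable]: "0 < n \<Longrightarrow> tilt V t n \<in> borel_measurable borel"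
  by (intro borel_measurable_continuous_onI continuous_tilt)

lemma integrable_tilt:
  assumes n: "0 < n" and [measurable]: "f \<in> borel_measurable borel" and B: "\<And>x. \<bar>f x\<bar> \<le> B"
  shows "integrable (normal_distr 0 (1 + t)) (\<lambda>x. f x * tilt V t n ((x + (real n - 1) * a) / real n))"
proof (rule N.integrable_const_bound[where B = B])
  note [measurable] = measurable_tilt[OF n]
  show "AE x in normal_distr 0 (1 + t). norm (f x * tilt V t n ((x + (real n - 1) * a) / real n)) \<le> B"
  proof (rule AE_I2)
    fix x
    have "\<bar>f x\<bar> * \<bar>tilt V t n ((x + (real n - 1) * a) / real n)\<bar> \<le> B * 1"
      using tilt_le_1[OF n] tilt_pos[OF n] B[of x] by (intro mult_mono) (auto simp: abs_of_pos less_imp_le)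
    then show "norm (f x * tilt V t n ((x + (real n - 1) * a) / real n)) \<le> B" by (simp add: abs_mult)
  qed
qed (use measurable_tilt[OF n] in measurable)

lemma tendsto_tilted_integral:
  assumes n: "0 < n" and f[measurable]: "f \<in> borel_measurable borel" and B: "\<And>x. \<bar>f x\<bar> \<le> B" and a: "a \<longlonglongrightarrow> b"
  shows "(\<lambda>k. tilted_integral V t n (a k) f) \<longlonglongrightarrow> tilted_integral V t n b f"
  unfolding tilted_integral_def
proof (rule integral_dominated_convergence[where w = "\<lambda>_. B"])
  note [measurable] = measurable_tilt[OF n]
  show "(\<lambda>x. f x * tilt V t n ((x + (real n - 1) * b) / real n)) \<in> borel_measurable (normal_distr 0 (1 + t))"
    by measurable
  show "(\<lambda>x. f x * tilt V t n ((x + (real n - 1) * a k) / real n)) \<in> borel_measurable (normal_distr 0 (1 + t))" for k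
    by measurable
  show "AE x in normal_distr 0 (1 + t). (\<lambda>k. f x * tilt V t n ((x + (real n - 1) * a k) / real n))
     \<longlonglongrightarrow> f x * tilt V t n ((x + (real n - 1) * b) / real n)"
    using n by (intro AE_I2 tendsto_intros a) auto
  fix k
  show "AE x in normal_distr 0 (1 + t). norm (f x * tilt V t n ((x + (real n - 1) * a k) / real n)) \<le> B"
  proof (rule AE_I2)
    fix x
    have "\<bar>f x\<bar> * \<bar>tilt V t n ((x + (real n - 1) * a k) / real n)\<bar> \<le> B * 1"
      using tilt_le_1[OF n] tilt_pos[OF n] B[of x] by (intro mult_mono) (auto simp: abs_of_pos less_imp_le)
    then show "norm (f x * tilt V t n ((x + (real n - 1) * a k) / real n)) \<le> B" by (simp add: abs_mult)
  qed
qed simp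

lemma continuous_tilted_integral:
  assumes "0 < n" "f \<in> borel_measurable borel" "\<And>x. \<bar>f x\<bar> \<le> B"
  shows "continuous_on UNIV (\<lambda>a. tilted_integral V t n a f)"
  using tendsto_tilted_integral[OF assms] by (auto simp: continuous_on_sequentially comp_def)

lemma tilted_integral_1_pos:
  assumes n: "0 < n" shows "0 < tilted_integral V t n a (\<lambda>_. 1)"
  unfolding tilted_integral_def
  using n by (intro N.integral_pos integrable_tilt[where B = 1]) (auto simp: tilt_pos)

lemma integral_cond_kernel:
  assumes n: "0 < n" and [measurable]: "f \<in> borel_measurable borel"
  shows "(\<integral>x. f x \<partial>cond_kernel V t n a) = tilted_integral V t n a f / tilted_integral V t n a (\<lambda>_. 1)"
proof -
  note [measurable] = measurable_tilt[OF n]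
  have "(\<integral>x. f x \<partial>cond_kernel V t n a) =
    (\<integral>x. (tilt V t n ((x + (real n - 1) * a) / real n) / tilted_integral V t n a (\<lambda>_. 1)) *\<^sub>R f x \<partial>normal_distr 0 (1 + t))"
    unfolding cond_kernel_def
    using less_imp_le[OF tilt_pos[OF n]] less_imp_le[OF tilted_integral_1_pos[OF n]]
    by (intro integral_density) auto
  also have "\<dots> = (\<integral>x. (f x * tilt V t n ((x + (real n - 1) * a) / real n)) / tilted_integral V t n a (\<lambda>_. 1) \<partial>normal_distr 0 (1 + t))"
    by (intro Bochner_Integration.integral_cong) (simp_all add: ac_simps)
  finally show ?thesis by (simp add: tilted_integral_def)
qed

lemma sets_cond_kernel [simp, measurable_cong]: "sets (cond_kernel V t n a) = sets borel"
  by (simp add: cond_kernel_def)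

lemma space_cond_kernel [simp]: "space (cond_kernel V t n a) = UNIV"
  by (simp add: cond_kernel_def)

lemma nn_integral_tilt_indicator:
  assumes n: "0 < n" and A[measurable]: "A \<in> sets borel"
  shows "(\<integral>\<^sup>+x. ennreal (tilt V t n ((x + (real n - 1) * a) / real n)) * indicator A x \<partial>normal_distr 0 (1 + t))
    = ennreal (tilted_integral V t n a (indicator A))"
proof -
  have "(\<integral>\<^sup>+x. ennreal (tilt V t n ((x + (real n - 1) * a) / real n)) * indicator A x \<partial>normal_distr 0 (1 + t))
    = (\<integral>\<^sup>+x. ennreal (indicator A x * tilt V t n ((x + (real n - 1) * a) / real n)) \<partial>normal_distr 0 (1 + t))"
    by (intro nn_integral_cong) (auto simp: indicator_def)
  also have "\<dots> = ennreal (tilted_integral V t n a (indicator A))"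
    unfolding tilted_integral_def
    using n less_imp_le[OF tilt_pos[OF n]]
    by (intro nn_integral_eq_integral integrable_tilt[where B = 1]) (auto simp: indicator_def)
  finally show ?thesis .
qed

lemma emeasure_cond_kernel:
  assumes n: "0 < n" and A[measurable]: "A \<in> sets borel"
  shows "emeasure (cond_kernel V t n a) A =
    ennreal (tilted_integral V t n a (indicator A) / tilted_integral V t n a (\<lambda>_. 1))"
proof -
  note [measurable] = measurable_tilt[OF n]
  let ?c = "1 / tilted_integral V t n a (\<lambda>_. 1)"
  have c: "0 \<le> ?c" using tilted_integral_1_pos[OF n, of a] by simp
  have "emeasure (cond_kernel V t n a) A =
    (\<integral>\<^sup>+x. ennreal (tilt V t n ((x + (real n - 1) * a) / real n) / tilted_integral V t n a (\<lambda>_. 1)) * indicator A x \<partial>normal_distr 0 (1 + t))"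
    unfolding cond_kernel_def by (intro emeasure_density) auto
  also have "\<dots> = (\<integral>\<^sup>+x. ennreal ?c * (ennreal (tilt V t n ((x + (real n - 1) * a) / real n)) * indicator A x) \<partial>normal_distr 0 (1 + t))"
    using c less_imp_le[OF tilt_pos[OF n]]
    by (intro nn_integral_cong) (simp add: ennreal_mult'[symmetric] mult.assoc[symmetric])
  also have "\<dots> = ennreal ?c * ennreal (tilted_integral V t n a (indicator A))"
    by (subst nn_integral_cmult) (auto simp: nn_integral_tilt_indicator[OF n A])
  also have "\<dots> = ennreal (tilted_integral V t n a (indicator A) / tilted_integral V t n a (\<lambda>_. 1))"
    using c by (simp add: ennreal_mult'[symmetric])
  finally show ?thesis .
qed

lemma prob_space_cond_kernel: 
  assumes n: "0 < n" shows "prob_space (cond_kernel V t n a)"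
proof (rule prob_spaceI)
  have "tilted_integral V t n a (indicator UNIV) = tilted_integral V t n a (\<lambda>_. 1)"
    by (simp add: tilted_integral_def)
  then show "emeasure (cond_kernel V t n a) (space (cond_kernel V t n a)) = 1"
    using tilted_integral_1_pos[OF n, of a] by (simp add: emeasure_cond_kernel[OF n])
qed

text \<open>The mass of a fixed Borel set is a quotient of functions continuous in \<open>a\<close>.
  The indicator may be discontinuous, since only the weight \<open>tilt\<close> sees
  \<open>a\<close>.\<close>

lemma measurable_cond_kernel:
  assumes n: "0 < n"
  shows "cond_kernel V t n \<in> borel \<rightarrow>\<^sub>M subprob_algebra borel"
proof (rule measurable_subprob_algebra)
  show "subprob_space (cond_kernel V t n a)" for a
    by (intro prob_space_imp_subprob_space prob_space_cond_kernel n)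
  fix A :: "real set" assume A: "A \<in> sets borel"
  have "continuous_on UNIV (\<lambda>a. tilted_integral V t n a (indicator A) / tilted_integral V t n a (\<lambda>_. 1))"
    using A tilted_integral_1_pos[OF n]
    by (intro continuous_on_divide continuous_tilted_integral[where B = 1] n ballI less_imp_neq[THEN not_sym])
      (auto simp: indicator_def)
  then show "(\<lambda>a. emeasure (cond_kernel V t n a) A) \<in> borel_measurable borel"
    unfolding emeasure_cond_kernel[OF n A]
    by (intro measurable_compose[OF borel_measurable_continuous_onI measurable_ennreal])
qed simp

text \<open>The joint law of the first spin and the others. An \<open>F\<close> that ignores the
  first spin yields the marginal, a product of two indicators the disintegration.\<close>

lemma nn_integral_time_evolved:
  assumes F[measurable]: "case_prod F \<in> borel_measurable (borel \<Otimes>\<^sub>M spins m)"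
  shows "(\<integral>\<^sup>+x. F (x 0) (drop_first (Suc m) x) \<partial>time_evolved V t (Suc m)) =
    ennreal (1 / partition_function V (Suc m)) *
    (\<integral>\<^sup>+y. \<integral>\<^sup>+x. ennreal (tilt V t (Suc m) ((x + real m * magnetisation m y) / real (Suc m))) * F x y
      \<partial>normal_distr 0 (1 + t) \<partial>iso_normal_distr m (\<lambda>_. 0) (1 + t))"
proof -
  let ?n = "Suc m" and ?c = "ennreal (1 / partition_function V (Suc m))"
  have n: "0 < ?n" by simp
  note [measurable] = measurable_tilt[OF n]
  have dm[measurable]: "drop_first ?n \<in> spins ?n \<rightarrow>\<^sub>M spins m" using measurable_drop_first[of ?n] by simp
  have [measurable]: "(\<lambda>x. F (x 0) (drop_first ?n x)) \<in> borel_measurable (spins ?n)"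
    using measurable_compose[OF _ F, of "\<lambda>x. (x 0, drop_first ?n x)" "spins ?n"] by simp
  have "(\<integral>\<^sup>+x. F (x 0) (drop_first ?n x) \<partial>time_evolved V t ?n) =
    (\<integral>\<^sup>+x. ?c * (ennreal (tilt V t ?n (magnetisation ?n x)) * F (x 0) (drop_first ?n x)) \<partial>iso_normal_distr ?n (\<lambda>_. 0) (1 + t))"
    unfolding time_evolved_eq_density[OF V_measurable V_nonneg t_pos n]
    by (subst nn_integral_density) (auto simp: mult.assoc)
  also have "\<dots> = ?c * (\<integral>\<^sup>+x. ennreal (tilt V t ?n (magnetisation ?n x)) * F (x 0) (drop_first ?n x) \<partial>iso_normal_distr ?n (\<lambda>_. 0) (1 + t))"
    by (rule nn_integral_cmult) measurable
  also have "(\<integral>\<^sup>+x. ennreal (tilt V t ?n (magnetisation ?n x)) * F (x 0) (drop_first ?n x) \<partial>iso_normal_distr ?n (\<lambda>_. 0) (1 + t)) =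
    (\<integral>\<^sup>+y. \<integral>\<^sup>+x. ennreal (tilt V t ?n ((x + real m * magnetisation m y) / real ?n)) * F x y
      \<partial>normal_distr 0 (1 + t) \<partial>iso_normal_distr m (\<lambda>_. 0) (1 + t))"
    by (subst nn_integral_iso_normal_distr_Suc[OF one_plus_t_pos], measurable)
       (intro nn_integral_cong, simp add: magnetisation_cons_spin drop_first_cons_spin)
  finally show ?thesis .
qed

lemma marginal_eq_density:
  "distr (time_evolved V t (Suc m)) (spins m) (drop_first (Suc m)) =
    density (iso_normal_distr m (\<lambda>_. 0) (1 + t)) (\<lambda>y. ennreal (1 / partition_function V (Suc m)) *
      ennreal (tilted_integral V t (Suc m) (magnetisation m y) (\<lambda>_. 1)))"
    (is "?M = density ?I ?D")
proof (rule measure_eqI)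
  have n: "0 < Suc m" by simp
  have dm[measurable]: "drop_first (Suc m) \<in> spins (Suc m) \<rightarrow>\<^sub>M spins m" using measurable_drop_first[of "Suc m"] by simp
  note [measurable_cong] = sets_time_evolved[OF V_measurable V_nonneg t_pos]
  have [measurable]: "(\<lambda>a. tilted_integral V t (Suc m) a (\<lambda>_. 1)) \<in> borel_measurable borel"
    by (intro borel_measurable_continuous_onI continuous_tilted_integral[where B = 1]) auto
  fix B assume "B \<in> sets ?M"
  then have B[measurable]: "B \<in> sets (spins m)" by simp
  have "emeasure ?M B = (\<integral>\<^sup>+y. indicator B y \<partial>?M)" by simp
  also have "\<dots> = (\<integral>\<^sup>+x. indicator B (drop_first (Suc m) x) \<partial>time_evolved V t (Suc m))"
    by (rule nn_integral_distr) measurable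
  also have "\<dots> = ennreal (1 / partition_function V (Suc m)) *
    (\<integral>\<^sup>+y. \<integral>\<^sup>+x. ennreal (tilt V t (Suc m) ((x + real m * magnetisation m y) / real (Suc m))) * indicator B y
      \<partial>normal_distr 0 (1 + t) \<partial>?I)"
    by (rule nn_integral_time_evolved) measurable
  also have "\<dots> = ennreal (1 / partition_function V (Suc m)) *
    (\<integral>\<^sup>+y. ennreal (tilted_integral V t (Suc m) (magnetisation m y) (\<lambda>_. 1)) * indicator B y \<partial>?I)"
  proof (intro arg_cong2[where f = "(*)"] refl nn_integral_cong)
    fix y
    have "(\<integral>\<^sup>+x. ennreal (tilt V t (Suc m) ((x + real m * magnetisation m y) / real (Suc m))) * indicator B y \<partial>normal_distr 0 (1 + t))
      = (\<integral>\<^sup>+x. ennreal (tilt V t (Suc m) ((x + real m * magnetisation m y) / real (Suc m))) \<partial>normal_distr 0 (1 + t)) * indicator B y"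
      using measurable_tilt[OF n] by (intro nn_integral_multc) measurable
    also have "(\<integral>\<^sup>+x. ennreal (tilt V t (Suc m) ((x + real m * magnetisation m y) / real (Suc m))) \<partial>normal_distr 0 (1 + t))
      = ennreal (tilted_integral V t (Suc m) (magnetisation m y) (\<lambda>_. 1))"
      using nn_integral_tilt_indicator[OF n, of UNIV "magnetisation m y"] by (simp add: tilted_integral_def)
    finally show "(\<integral>\<^sup>+x. ennreal (tilt V t (Suc m) ((x + real m * magnetisation m y) / real (Suc m))) * indicator B y \<partial>normal_distr 0 (1 + t))
      = ennreal (tilted_integral V t (Suc m) (magnetisation m y) (\<lambda>_. 1)) * indicator B y" .
  qed
  also have "\<dots> = emeasure (density ?I ?D) B"
    by (simp add: emeasure_density nn_integral_cmult[symmetric] mult.assoc)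
  finally show "emeasure ?M B = emeasure (density ?I ?D) B" .
qed simp

lemma regular_cond_prob_first_cond_kernel:
  assumes n: "2 \<le> n"
  shows "regular_cond_prob_first n (time_evolved V t n) (\<lambda>y. cond_kernel V t n (magnetisation (n - 1) y))"
proof -
  obtain m where nm: "n = Suc m" using n by (cases n) auto
  have n0: "0 < n" "0 < Suc m" using n by auto
  have dm[measurable]: "drop_first (Suc m) \<in> spins (Suc m) \<rightarrow>\<^sub>M spins m" using measurable_drop_first[of "Suc m"] by simp
  note [measurable_cong] = sets_time_evolved[OF V_measurable V_nonneg t_pos]
  have tm[measurable]: "(\<lambda>a. tilted_integral V t (Suc m) a f) \<in> borel_measurable borel"
    if "f \<in> borel_measurable borel" "\<And>x. \<bar>f x\<bar> \<le> 1" for f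
    by (intro borel_measurable_continuous_onI continuous_tilted_integral[where B = 1] that) auto
  let ?I = "iso_normal_distr m (\<lambda>_. 0) (1 + t)" and ?c = "ennreal (1 / partition_function V (Suc m))"
  have K: "(\<lambda>y. cond_kernel V t (Suc m) (magnetisation m y)) \<in> spins m \<rightarrow>\<^sub>M subprob_algebra borel"
    by (rule measurable_compose[OF borel_measurable_magnetisation measurable_cond_kernel]) simp
  show ?thesis
    unfolding regular_cond_prob_first_def nm diff_Suc_1
  proof (intro conjI ballI K)
    fix A :: "real set" and B assume A[measurable]: "A \<in> sets borel" and B[measurable]: "B \<in> sets (spins m)"
    let ?S = "{x \<in> space (spins (Suc m)). x 0 \<in> A \<and> drop_first (Suc m) x \<in> B}"
    have [measurable]: "(\<lambda>a. tilted_integral V t (Suc m) a (indicator A)) \<in> borel_measurable borel"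
      by (rule tm) (auto simp: indicator_def)
    have [measurable]: "(\<lambda>a. tilted_integral V t (Suc m) a (\<lambda>_. 1)) \<in> borel_measurable borel"
      by (rule tm) auto
    have S: "?S \<in> sets (time_evolved V t (Suc m))" by measurable
    have "emeasure (time_evolved V t (Suc m)) ?S = (\<integral>\<^sup>+x. indicator ?S x \<partial>time_evolved V t (Suc m))"
      using S by simp
    also have "\<dots> = (\<integral>\<^sup>+x. indicator A (x 0) * indicator B (drop_first (Suc m) x) \<partial>time_evolved V t (Suc m))"
      using sets_eq_imp_space_eq[OF sets_time_evolved[OF V_measurable V_nonneg t_pos]]
      by (intro nn_integral_cong) (auto simp: indicator_def)
    also have "\<dots> = ?c * (\<integral>\<^sup>+y. \<integral>\<^sup>+x. ennreal (tilt V t (Suc m) ((x + real m * magnetisation m y) / real (Suc m))) *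
        (indicator A x * indicator B y) \<partial>normal_distr 0 (1 + t) \<partial>?I)"
      by (rule nn_integral_time_evolved) measurable
    also have "\<dots> = ?c * (\<integral>\<^sup>+y. ennreal (tilted_integral V t (Suc m) (magnetisation m y) (indicator A)) * indicator B y \<partial>?I)"
    proof (intro arg_cong2[where f = "(*)"] refl nn_integral_cong)
      fix y
      have "(\<integral>\<^sup>+x. ennreal (tilt V t (Suc m) ((x + real m * magnetisation m y) / real (Suc m))) * (indicator A x * indicator B y) \<partial>normal_distr 0 (1 + t))
        = (\<integral>\<^sup>+x. ennreal (tilt V t (Suc m) ((x + real m * magnetisation m y) / real (Suc m))) * indicator A x * indicator B y \<partial>normal_distr 0 (1 + t))"
        by (simp only: mult.assoc)
      also have "\<dots> = (\<integral>\<^sup>+x. ennreal (tilt V t (Suc m) ((x + real m * magnetisation m y) / real (Suc m))) * indicator A x \<partial>normal_distr 0 (1 + t)) * indicator B y"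
        using measurable_tilt[OF n0(2)] by (intro nn_integral_multc) measurable
      also have "(\<integral>\<^sup>+x. ennreal (tilt V t (Suc m) ((x + real m * magnetisation m y) / real (Suc m))) * indicator A x \<partial>normal_distr 0 (1 + t))
        = ennreal (tilted_integral V t (Suc m) (magnetisation m y) (indicator A))"
        using nn_integral_tilt_indicator[OF n0(2) A, of "magnetisation m y"] by simp
      finally show "(\<integral>\<^sup>+x. ennreal (tilt V t (Suc m) ((x + real m * magnetisation m y) / real (Suc m))) * (indicator A x * indicator B y) \<partial>normal_distr 0 (1 + t))
        = ennreal (tilted_integral V t (Suc m) (magnetisation m y) (indicator A)) * indicator B y" .
    qed
    \<comment> \<open>The normaliser of the kernel is, up to \<open>?c\<close>, also the density of
      the marginal of the other spins; multiplying and dividing by it exhibits the kernel integrated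
      against the marginal.\<close>
    also have "\<dots> = (\<integral>\<^sup>+y. ?c * ennreal (tilted_integral V t (Suc m) (magnetisation m y) (\<lambda>_. 1)) *
        (indicator B y * emeasure (cond_kernel V t (Suc m) (magnetisation m y)) A) \<partial>?I)"
    proof (subst nn_integral_cmult[symmetric], measurable, rule nn_integral_cong)
      fix y
      have p: "0 < tilted_integral V t (Suc m) (magnetisation m y) (\<lambda>_. 1)" by (rule tilted_integral_1_pos) simp
      have "ennreal (tilted_integral V t (Suc m) (magnetisation m y) (\<lambda>_. 1)) * emeasure (cond_kernel V t (Suc m) (magnetisation m y)) A
        = ennreal (tilted_integral V t (Suc m) (magnetisation m y) (indicator A))"
        unfolding emeasure_cond_kernel[OF n0(2) A] using p by (subst ennreal_mult'[symmetric]) auto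
      then show "?c * (ennreal (tilted_integral V t (Suc m) (magnetisation m y) (indicator A)) * indicator B y) =
        ?c * ennreal (tilted_integral V t (Suc m) (magnetisation m y) (\<lambda>_. 1)) *
          (indicator B y * emeasure (cond_kernel V t (Suc m) (magnetisation m y)) A)"
        by (metis mult.assoc mult.commute)
    qed
    also have "\<dots> = (\<integral>\<^sup>+y. indicator B y * emeasure (cond_kernel V t (Suc m) (magnetisation m y)) A
        \<partial>distr (time_evolved V t (Suc m)) (spins m) (drop_first (Suc m)))"
      unfolding marginal_eq_density
      using measurable_emeasure_kernel[OF K A] by (subst nn_integral_density) auto
    finally show "emeasure (time_evolved V t (Suc m)) ?S =
      (\<integral>\<^sup>+y. indicator B y * emeasure (cond_kernel V t (Suc m) (magnetisation m y)) A
        \<partial>distr (time_evolved V t (Suc m)) (spins m) (drop_first (Suc m)))" .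
  qed
qed

end

section \<open>Uniqueness of the conditional law\<close>

text \<open>\<open>sets_PiM_equal_borel\<close> concerns full sequences. The preimage
  \<open>?W\<close> of \<open>U\<close> under restriction is open there, hence measurable, and
  pulling it back along the measurable extension by zero \<open>e\<close> returns
  \<open>U\<close>.\<close>

lemma openin_spin_topology_measurable:
  assumes U: "openin (spin_topology m) U"
  shows "U \<in> sets (spins m)"
proof -
  define e :: "(nat \<Rightarrow> real) \<Rightarrow> (nat \<Rightarrow> real)" where "e = (\<lambda>x i. if i < m then x i else 0)"
  let ?W = "{x. restrict x {..<m} \<in> U}"
  have "continuous_map euclidean (spin_topology m) (\<lambda>x::nat \<Rightarrow> real. restrict x {..<m})"
    by (auto simp: continuous_map_componentwise continuous_on_product_coordinates)
  then have "open ?W"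
    using openin_continuous_map_preimage[OF _ U] by fastforce
  then have W: "?W \<in> sets (\<Pi>\<^sub>M i\<in>UNIV. borel)"
    unfolding sets_PiM_equal_borel by simp
  have e: "e \<in> spins m \<rightarrow>\<^sub>M (\<Pi>\<^sub>M i\<in>UNIV. borel)"
    unfolding e_def
  proof (rule measurable_PiM_single')
    fix i :: nat
    show "(\<lambda>x. if i < m then x i else 0) \<in> borel_measurable (spins m)"
      by (cases "i < m") auto
  qed auto
  have "U \<subseteq> space (spins m)"
    using openin_subset[OF U] unfolding topspace_spin_topology .
  moreover have "restrict (e x) {..<m} = x" if "x \<in> space (spins m)" for x
    using that by (auto simp: e_def space_PiM PiE_iff extensional_def fun_eq_iff)
  ultimately have "U = e -` ?W \<inter> space (spins m)" by auto
  also have "\<dots> \<in> sets (spins m)" using e W by (rule measurable_sets)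
  finally show ?thesis .
qed

section \<open>Full support of Gaussian measures\<close>

lemma emeasure_normal_distr_open_pos:
  assumes v: "0 < v" and U: "open U" "x \<in> U"
  shows "0 < emeasure (normal_distr a v) U"
proof (rule ccontr)
  assume "\<not> ?thesis"
  then have "emeasure (normal_distr a v) U = 0" by simp
  with U have "U \<in> null_sets (density lborel (\<lambda>x. ennreal (normal_density a (sqrt v) x)))"
    by (simp add: null_sets_def normal_distr_def)
  then have "AE x in lborel. x \<in> U \<longrightarrow> ennreal (normal_density a (sqrt v) x) = 0"
    by (subst (asm) null_sets_density_iff) auto
  moreover have "ennreal (normal_density a (sqrt v) x) \<noteq> 0" for x
    using normal_density_pos[of "sqrt v" a x] v by (simp add: ennreal_eq_0_iff not_le)
  ultimately have "AE x in lborel. x \<notin> U" by simp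
  then have "emeasure lborel U = 0"
    using U by (subst (asm) AE_iff_measurable[where N = U]) auto
  moreover obtain e where e: "0 < e" "ball x e \<subseteq> U" using U by (meson openE)
  then have "emeasure lborel {x <..< x + e} \<le> emeasure lborel U"
    using U by (intro emeasure_mono) (auto simp: ball_def dist_real_def subset_iff)
  ultimately show False using e by simp
qed

lemma emeasure_iso_normal_distr_open_pos:
  assumes v: "0 < v" and U: "openin (spin_topology m) U" "y \<in> U"
  shows "0 < emeasure (iso_normal_distr m z v) U"
proof -
  interpret P: product_prob_space "\<lambda>i. normal_distr (z i) v" "{..<m}"
    by (rule product_prob_spaceI) (rule prob_space_normal_distr[OF v])
  obtain B where B: "\<And>i. i < m \<Longrightarrow> open (B i)" "y \<in> Pi\<^sub>E {..<m} B" "Pi\<^sub>E {..<m} B \<subseteq> U"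
  proof -
    from U(1)[unfolded openin_product_topology_alt, rule_format, OF U(2)]
    obtain B where "\<forall>i\<in>{..<m}. openin euclideanreal (B i)" "y \<in> Pi\<^sub>E {..<m} B" "Pi\<^sub>E {..<m} B \<subseteq> U"
      by blast
    then show ?thesis by (intro that[of B]) simp_all
  qed
  have "0 < (\<Prod>i<m. emeasure (normal_distr (z i) v) (B i))"
  proof -
    have "emeasure (normal_distr (z i) v) (B i) \<noteq> 0" if "i < m" for i
      using emeasure_normal_distr_open_pos[OF v B(1)[OF that], of "y i" "z i"] B(2) that by (auto simp: PiE_iff)
    then show ?thesis by (simp add: zero_less_iff_neq_zero)
  qed
  also have "\<dots> = emeasure (iso_normal_distr m z v) (Pi\<^sub>E {..<m} B)"
    unfolding iso_normal_distr_def using B(1) by (subst P.emeasure_PiM) auto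
  also have "\<dots> \<le> emeasure (iso_normal_distr m z v) U"
    using B(3) openin_spin_topology_measurable[OF U(1)] by (intro emeasure_mono) auto
  finally show ?thesis .
qed

lemma continuous_map_magnetisation: "continuous_map (spin_topology m) euclideanreal (magnetisation m)"
  unfolding magnetisation_def[abs_def] divide_inverse
  by (intro continuous_map_real_mult_right continuous_map_sum continuous_map_product_projection) auto

text \<open>Both kernels disintegrate the same joint law, tested on the sets \<^term>\<open>A \<times> B\<close>; binding the
  marginal restricted to \<^term>\<open>B\<close> with them extends the identity from sets \<^term>\<open>A\<close> to functions.\<close>

lemma AE_nn_integral_eq_if_emeasure_eq:
  assumes N: "prob_space N"
    and K: "K \<in> N \<rightarrow>\<^sub>M subprob_algebra M" and L: "L \<in> N \<rightarrow>\<^sub>M subprob_algebra M"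
    and eq: "\<And>A B. A \<in> sets M \<Longrightarrow> B \<in> sets N \<Longrightarrow>
      (\<integral>\<^sup>+y. indicator B y * emeasure (K y) A \<partial>N) = (\<integral>\<^sup>+y. indicator B y * emeasure (L y) A \<partial>N)"
    and f[measurable]: "f \<in> borel_measurable M"
  shows "AE y in N. (\<integral>\<^sup>+x. f x \<partial>K y) = (\<integral>\<^sup>+x. f x \<partial>L y)"
proof -
  interpret prob_space N by fact
  have mK: "(\<lambda>y. \<integral>\<^sup>+x. f x \<partial>K y) \<in> borel_measurable N"
    by (rule measurable_compose[OF K nn_integral_measurable_subprob_algebra]) measurable
  have mL: "(\<lambda>y. \<integral>\<^sup>+x. f x \<partial>L y) \<in> borel_measurable N"
    by (rule measurable_compose[OF L nn_integral_measurable_subprob_algebra]) measurable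
  have "density N (\<lambda>y. \<integral>\<^sup>+x. f x \<partial>K y) = density N (\<lambda>y. \<integral>\<^sup>+x. f x \<partial>L y)"
  proof (rule measure_eqI)
    fix B assume "B \<in> sets (density N (\<lambda>y. \<integral>\<^sup>+x. f x \<partial>K y))"
    then have B[measurable]: "B \<in> sets N" by simp
    let ?N = "density N (indicator B)"
    have K': "K \<in> ?N \<rightarrow>\<^sub>M subprob_algebra M" and L': "L \<in> ?N \<rightarrow>\<^sub>M subprob_algebra M"
      using K L by simp_all
    have ne: "space ?N \<noteq> {}" using not_empty by simp
    have "?N \<bind> K = ?N \<bind> L"
    proof (rule measure_eqI)
      show "sets (?N \<bind> K) = sets (?N \<bind> L)"
        using sets_bind[OF sets_kernel[OF K'] ne] sets_bind[OF sets_kernel[OF L'] ne] by simp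
      fix A assume "A \<in> sets (?N \<bind> K)"
      then have A: "A \<in> sets M" using sets_bind[OF sets_kernel[OF K'] ne] by simp
      show "emeasure (?N \<bind> K) A = emeasure (?N \<bind> L) A"
        unfolding emeasure_bind[OF ne K' A] emeasure_bind[OF ne L' A]
        using eq[OF A B] measurable_emeasure_kernel[OF K A] measurable_emeasure_kernel[OF L A]
        by (simp add: nn_integral_density)
    qed
    then have "(\<integral>\<^sup>+x. f x \<partial>(?N \<bind> K)) = (\<integral>\<^sup>+x. f x \<partial>(?N \<bind> L))" by simp
    then show "emeasure (density N (\<lambda>y. \<integral>\<^sup>+x. f x \<partial>K y)) B = emeasure (density N (\<lambda>y. \<integral>\<^sup>+x. f x \<partial>L y)) B"
      unfolding nn_integral_bind[OF f K'] nn_integral_bind[OF f L']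
      using mK mL by (simp add: nn_integral_density emeasure_density mult.commute)
  qed simp
  then show ?thesis
    using density_unique_iff[OF mK mL] by simp
qed

context mean_field
begin

lemma weakly_continuous_cond_kernel:
  assumes n: "0 < n"
  shows "weakly_continuous_kernel m (\<lambda>y. cond_kernel V t n (magnetisation m y))"
  unfolding weakly_continuous_kernel_def
proof (intro allI impI)
  fix f :: "real \<Rightarrow> real" assume f: "continuous_on UNIV f \<and> bounded (range f)"
  then obtain B where B: "\<And>x. \<bar>f x\<bar> \<le> B" by (auto simp: bounded_iff)
  have fm: "f \<in> borel_measurable borel" using f by (intro borel_measurable_continuous_onI) simp
  have "continuous_on UNIV (\<lambda>a. tilted_integral V t n a f / tilted_integral V t n a (\<lambda>_. 1))"
    using tilted_integral_1_pos[OF n]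
    by (intro continuous_on_divide continuous_tilted_integral[OF n fm B]
        continuous_tilted_integral[where B = 1] n ballI less_imp_neq[THEN not_sym]) auto
  then have "continuous_map euclideanreal euclideanreal (\<lambda>a. \<integral>x. f x \<partial>cond_kernel V t n a)"
    by (simp add: integral_cond_kernel[OF n fm])
  from continuous_map_compose[OF continuous_map_magnetisation this]
  show "continuous_map (spin_topology m) euclideanreal (\<lambda>y. \<integral>x. f x \<partial>cond_kernel V t n (magnetisation m y))"
    by (simp add: comp_def)
qed

lemma marginal_open_pos:
  assumes U: "openin (spin_topology m) U" "y \<in> U"
  shows "0 < emeasure (distr (time_evolved V t (Suc m)) (spins m) (drop_first (Suc m))) U"
proof (rule ccontr)
  let ?D = "\<lambda>y. ennreal (1 / partition_function V (Suc m)) *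
      ennreal (tilted_integral V t (Suc m) (magnetisation m y) (\<lambda>_. 1))"
  have [measurable]: "(\<lambda>a. tilted_integral V t (Suc m) a (\<lambda>_. 1)) \<in> borel_measurable borel"
    by (intro borel_measurable_continuous_onI continuous_tilted_integral[where B = 1]) auto
  note Um[measurable] = openin_spin_topology_measurable[OF U(1)]
  assume "\<not> ?thesis"
  then have "U \<in> null_sets (density (iso_normal_distr m (\<lambda>_. 0) (1 + t)) ?D)"
    unfolding marginal_eq_density using Um by (simp add: null_sets_def)
  then have "AE y in iso_normal_distr m (\<lambda>_. 0) (1 + t). y \<in> U \<longrightarrow> ?D y = 0"
    by (subst (asm) null_sets_density_iff) auto
  moreover have "?D y \<noteq> 0" for y
    using partition_function_pos[OF V_measurable V_nonneg, of "Suc m"] tilted_integral_1_pos[of "Suc m" "magnetisation m y"]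
    by (auto simp: ennreal_mult_eq_top_iff ennreal_eq_0_iff)
  ultimately have "AE y in iso_normal_distr m (\<lambda>_. 0) (1 + t). y \<notin> U" by simp
  then have "emeasure (iso_normal_distr m (\<lambda>_. 0) (1 + t)) U = 0"
    using Um sets.sets_into_space[OF Um] by (subst (asm) AE_iff_measurable[where N = U]) auto
  then show False using emeasure_iso_normal_distr_open_pos[OF one_plus_t_pos U, of "\<lambda>_. 0"] by simp
qed

text \<open>The marginal charges every nonempty open set, so its support is the whole space and
  properness becomes vacuous for an arbitrary \<open>\<gamma>\<close>.\<close>

lemma proper_kernel_time_evolved: 
  assumes n: "2 \<le> n"
  shows "proper_kernel n (time_evolved V t n) \<gamma>"
proof -
  obtain m where "n = Suc m" using n by (cases n) auto
  then show ?thesis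
    using marginal_open_pos by (auto simp: proper_kernel_def spin_support_def)
qed

text \<open>Two disintegrations agree almost everywhere. By weak continuity the set \<open>D\<close>
  on which the integrals of \<open>f\<close> differ is open; being null for a measure of full
  support, it is empty.\<close>

lemma cond_prob_unique:
  fixes f :: "real \<Rightarrow> real"
  assumes n: "2 \<le> n" and reg: "regular_cond_prob_first n (time_evolved V t n) \<gamma>"
    and cont: "weakly_continuous_kernel (n - 1) \<gamma>"
    and f: "continuous_on UNIV f" "bounded (range f)" and y: "y \<in> space (spins (n - 1))"
  shows "(\<integral>x. f x \<partial>\<gamma> y) = (\<integral>x. f x \<partial>cond_kernel V t n (magnetisation (n - 1) y))"
proof -
  obtain m where nm: "n = Suc m" using n by (cases n) auto
  let ?N = "distr (time_evolved V t n) (spins (n - 1)) (drop_first n)"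
  let ?K = "\<lambda>y. cond_kernel V t n (magnetisation (n - 1) y)"
  have n0: "0 < n" using n by simp
  note regK = regular_cond_prob_first_cond_kernel[OF n]
  have mg: "\<gamma> \<in> spins (n - 1) \<rightarrow>\<^sub>M subprob_algebra borel" and mK: "?K \<in> spins (n - 1) \<rightarrow>\<^sub>M subprob_algebra borel"
    using reg regK by (simp_all add: regular_cond_prob_first_def)
  have sp: "subprob_space (\<gamma> y)" "sets (\<gamma> y) = sets borel" if "y \<in> space (spins (n - 1))" for y
    using measurable_space[OF mg that] by (auto simp: space_subprob_algebra)
  have fm[measurable]: "f \<in> borel_measurable borel" using f by (intro borel_measurable_continuous_onI)
  have N: "prob_space ?N"
    using prob_space_time_evolved[OF V_measurable V_nonneg t_pos]
    by (rule prob_space.prob_space_distr)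
      (use measurable_drop_first[of n] in \<open>simp add: sets_time_evolved[OF V_measurable V_nonneg t_pos] cong: measurable_cong_sets\<close>)
  have ae: "AE y in ?N. (\<integral>\<^sup>+x. g x \<partial>\<gamma> y) = (\<integral>\<^sup>+x. g x \<partial>?K y)" if "g \<in> borel_measurable borel" for g
  proof (rule AE_nn_integral_eq_if_emeasure_eq[OF N])
    show "(\<integral>\<^sup>+y. indicator B y * emeasure (\<gamma> y) A \<partial>?N) = (\<integral>\<^sup>+y. indicator B y * emeasure (?K y) A \<partial>?N)"
      if "A \<in> sets borel" "B \<in> sets ?N" for A B
      using that reg regK by (simp add: regular_cond_prob_first_def)
  qed (use mg mK that in simp_all)
  have int: "integrable M f" if "subprob_space M" "sets M = sets borel" for M
  proof -
    interpret subprob_space M by fact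
    have [measurable_cong]: "sets M = sets borel" by fact
    obtain B where "\<And>x. \<bar>f x\<bar> \<le> B" using f by (auto simp: bounded_iff)
    then show ?thesis by (intro integrable_const_bound[where B = B]) auto
  qed
  \<comment> \<open>Almost everywhere equality is available for nonnegative integrals only, hence
    the split of \<open>f\<close> into positive and negative part, which
    \<open>ennreal (f x)\<close> and \<open>ennreal (- f x)\<close> encode by truncation at
    0.\<close>
  have "AE y in ?N. (\<integral>x. f x \<partial>\<gamma> y) = (\<integral>x. f x \<partial>?K y)"
    using ae[of "\<lambda>x. ennreal (f x)", simplified] ae[of "\<lambda>x. ennreal (- f x)", simplified] AE_space
  proof eventually_elim
    case (elim y)
    then have y: "y \<in> space (spins (n - 1))" by simp
    show "(\<integral>x. f x \<partial>\<gamma> y) = (\<integral>x. f x \<partial>?K y)"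
      using elim(1,2) int[OF sp[OF y]] int[OF prob_space_imp_subprob_space[OF prob_space_cond_kernel[OF n0]] sets_cond_kernel]
      by (simp add: real_lebesgue_integral_def)
  qed
  moreover define D where "D = {y \<in> topspace (spin_topology (n - 1)). (\<integral>x. f x \<partial>\<gamma> y) - (\<integral>x. f x \<partial>?K y) \<in> - {0}}"
  have "openin (spin_topology (n - 1)) D"
    unfolding D_def
    by (rule openin_continuous_map_preimage[OF continuous_map_diff])
      (use cont f weakly_continuous_cond_kernel[OF n0] in \<open>auto simp: weakly_continuous_kernel_def\<close>)
  moreover from openin_spin_topology_measurable[OF this] have "D \<in> sets ?N" by simp
  ultimately have "emeasure ?N D = 0"
    by (subst (asm) AE_iff_measurable[where N = D]) (auto simp: D_def space_PiM)
  then have "y \<notin> D"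
    using marginal_open_pos[of m D] \<open>openin (spin_topology (n - 1)) D\<close> by (auto simp: nm)
  with y show ?thesis by (auto simp: D_def space_PiM)
qed

text \<open>Uniqueness replaces the existentially quantified kernels by \<open>cond_kernel\<close>,
  which sees a configuration only through its magnetisation; configurations thereby give way to real
  sequences.\<close>

theorem limiting_cond_prob_iff:
  "limiting_cond_prob (time_evolved V t) \<alpha> \<nu> \<longleftrightarrow>
    prob_space \<nu> \<and> sets \<nu> = sets borel \<and>
    (\<forall>a. a \<longlonglongrightarrow> \<alpha> \<longrightarrow> converges_weakly (\<lambda>n. cond_kernel V t n (a n)) \<nu>)"
proof (intro iffI conjI allI impI)
  assume "limiting_cond_prob (time_evolved V t) \<alpha> \<nu>"
  then obtain \<gamma> where \<nu>: "prob_space \<nu>" "sets \<nu> = sets borel"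
    and *: "\<forall>n\<ge>2. regular_cond_prob_first n (time_evolved V t n) (\<gamma> n) \<and>
        proper_kernel n (time_evolved V t n) (\<gamma> n) \<and> weakly_continuous_kernel (n - 1) (\<gamma> n)"
    and lim: "\<forall>v. (\<forall>n\<ge>2. v (n - 1) \<in> space (spins (n - 1))) \<and>
        (\<lambda>n. magnetisation (n - 1) (v (n - 1))) \<longlonglongrightarrow> \<alpha> \<longrightarrow>
        converges_weakly (\<lambda>n. \<gamma> n (v (n - 1))) \<nu>"
    unfolding limiting_cond_prob_def by blast
  from \<nu> show "prob_space \<nu>" "sets \<nu> = sets borel" .
  from * have \<gamma>: "regular_cond_prob_first n (time_evolved V t n) (\<gamma> n)"
      "weakly_continuous_kernel (n - 1) (\<gamma> n)" if "2 \<le> n" for n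
    using that by blast+
  fix a :: "nat \<Rightarrow> real" assume a: "a \<longlonglongrightarrow> \<alpha>"
  \<comment> \<open>Constant configurations realise any magnetisation. The value
    \<open>a (Suc k)\<close> compensates the shift, so that \<open>v (n - 1)\<close> has
    magnetisation \<open>a n\<close> for \<open>2 \<le> n\<close>.\<close>
  define v :: "nat \<Rightarrow> nat \<Rightarrow> real" where "v = (\<lambda>k. \<lambda>i\<in>{..<k}. a (Suc k))"
  have sp: "v k \<in> space (spins k)" for k by (simp add: v_def space_PiM)
  have mag: "magnetisation (n - 1) (v (n - 1)) = a n" if "2 \<le> n" for n
    using that by (simp add: magnetisation_def v_def)
  have "(\<lambda>n. magnetisation (n - 1) (v (n - 1))) \<longlonglongrightarrow> \<alpha>"
    by (rule Lim_transform_eventually[OF a])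
      (use mag in \<open>auto simp: eventually_sequentially intro!: exI[of _ 2]\<close>)
  with lim sp have *: "converges_weakly (\<lambda>n. \<gamma> n (v (n - 1))) \<nu>" by blast
  show "converges_weakly (\<lambda>n. cond_kernel V t n (a n)) \<nu>"
    unfolding converges_weakly_def
  proof (intro allI impI)
    fix f :: "real \<Rightarrow> real" assume f: "continuous_on UNIV f \<and> bounded (range f)"
    with * have "(\<lambda>n. \<integral>x. f x \<partial>\<gamma> n (v (n - 1))) \<longlonglongrightarrow> (\<integral>x. f x \<partial>\<nu>)"
      by (simp add: converges_weakly_def)
    moreover have "(\<integral>x. f x \<partial>\<gamma> n (v (n - 1))) = (\<integral>x. f x \<partial>cond_kernel V t n (a n))" if "2 \<le> n" for n
      using cond_prob_unique[OF that \<gamma>(1)[OF that] \<gamma>(2)[OF that], of f "v (n - 1)"] f sp mag[OF that] by simp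
    then have "\<forall>\<^sub>F n in sequentially. (\<integral>x. f x \<partial>\<gamma> n (v (n - 1))) = (\<integral>x. f x \<partial>cond_kernel V t n (a n))"
      by (auto simp: eventually_sequentially intro!: exI[of _ 2])
    ultimately show "(\<lambda>n. \<integral>x. f x \<partial>cond_kernel V t n (a n)) \<longlonglongrightarrow> (\<integral>x. f x \<partial>\<nu>)"
      by (rule Lim_transform_eventually)
  qed
next
  assume *: "prob_space \<nu> \<and> sets \<nu> = sets borel \<and>
    (\<forall>a. a \<longlonglongrightarrow> \<alpha> \<longrightarrow> converges_weakly (\<lambda>n. cond_kernel V t n (a n)) \<nu>)"
  show "limiting_cond_prob (time_evolved V t) \<alpha> \<nu>"
    unfolding limiting_cond_prob_def
  proof (intro conjI exI[of _ "\<lambda>n y. cond_kernel V t n (magnetisation (n - 1) y)"] allI impI)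
    fix n :: nat assume n: "2 \<le> n"
    show "regular_cond_prob_first n (time_evolved V t n) (\<lambda>y. cond_kernel V t n (magnetisation (n - 1) y))"
      by (rule regular_cond_prob_first_cond_kernel[OF n])
    show "proper_kernel n (time_evolved V t n) (\<lambda>y. cond_kernel V t n (magnetisation (n - 1) y))"
      by (rule proper_kernel_time_evolved[OF n])
    show "weakly_continuous_kernel (n - 1) (\<lambda>y. cond_kernel V t n (magnetisation (n - 1) y))"
      using n by (intro weakly_continuous_cond_kernel) simp
  qed (use * in auto)
qed

end

section \<open>Weak limits\<close>

lemma integral_normal_distr:
  fixes f :: "real \<Rightarrow> real"
  assumes [measurable]: "f \<in> borel_measurable borel"
  shows "(\<integral>x. f x \<partial>normal_distr a v) = (\<integral>x. normal_density a (sqrt v) x * f x \<partial>lborel)"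
  unfolding normal_distr_def by (subst integral_density) auto

lemma integrable_exp_neg_square:
  assumes c: "0 < c" shows "integrable lborel (\<lambda>s::real. exp (- (c * (s - b)\<^sup>2)))"
proof -
  define \<sigma> where "\<sigma> = sqrt (1 / (2 * c))"
  have \<sigma>: "0 < \<sigma>" "\<sigma>\<^sup>2 = 1 / (2 * c)" using c by (simp_all add: \<sigma>_def)
  have "exp (- (c * (s - b)\<^sup>2)) = sqrt (2 * pi * \<sigma>\<^sup>2) * normal_density b \<sigma> s" for s
    using c \<sigma>(1) unfolding normal_density_def \<sigma>(2) by (simp add: field_simps real_sqrt_mult real_sqrt_divide)
  moreover have "integrable lborel (\<lambda>s. sqrt (2 * pi * \<sigma>\<^sup>2) * normal_density b \<sigma> s)"
    by (intro integrable_mult_right integrable_normal_density \<sigma>)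
  ultimately show ?thesis by simp
qed

text \<open>Stated for an arbitrary filter because it is used along sequences, along neighbourhoods
  of a point and along products of both. Dominated convergence is sequential, so it first gives
  joint continuity in mean and variance, which is then composed with the filter.\<close>

lemma tendsto_normal_average:
  fixes f :: "real \<Rightarrow> real"
  assumes f: "continuous_on UNIV f" "bounded (range f)" and m: "(m \<longlongrightarrow> m0) F" and v: "(v \<longlongrightarrow> v0) F"
  shows "((\<lambda>p. \<integral>x. f (m p + sqrt (v p) * x) \<partial>std_normal_distribution) \<longlongrightarrow>
    (\<integral>x. f (m0 + sqrt v0 * x) \<partial>std_normal_distribution)) F"
proof -
  interpret std: prob_space std_normal_distribution by (rule prob_space_normal_density) simp
  let ?G = "\<lambda>p. \<integral>x. f (fst p + sqrt (snd p) * x) \<partial>std_normal_distribution"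
  obtain B where B: "\<And>x. \<bar>f x\<bar> \<le> B" using f(2) by (auto simp: bounded_iff)
  have [measurable]: "f \<in> borel_measurable borel" using f(1) by (rule borel_measurable_continuous_onI)
  have "isCont ?G (m0, v0)"
    unfolding continuous_at_sequentially comp_def
  proof (intro allI impI)
    fix p :: "nat \<Rightarrow> real \<times> real" assume p: "p \<longlonglongrightarrow> (m0, v0)"
    show "(\<lambda>n. ?G (p n)) \<longlonglongrightarrow> ?G (m0, v0)"
    proof (rule integral_dominated_convergence[where w = "\<lambda>_. B"])
      show "AE x in std_normal_distribution. (\<lambda>n. f (fst (p n) + sqrt (snd (p n)) * x)) \<longlonglongrightarrow>
          f (fst (m0, v0) + sqrt (snd (m0, v0)) * x)"
        by (intro AE_I2 continuous_on_tendsto_compose[OF f(1)] tendsto_intros p) auto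
    qed (use B in auto)
  qed
  from isCont_tendsto_compose[OF this tendsto_Pair[OF m v]] show ?thesis by simp
qed

text \<open>Near \<open>q\<close> the integrand is within \<open>e / 2\<close> of \<open>L\<close>,
  uniformly for large \<open>n\<close>; elsewhere the error is at most
  \<open>B + \<bar>L\<bar>\<close> on a set of vanishing mass. Convergence along the product filter
  is what lets the integrand vary with \<open>n\<close>.\<close>

lemma tendsto_integral_concentrating:
  fixes h :: "nat \<Rightarrow> real \<Rightarrow> real"
  assumes \<mu>: "\<And>n. 0 < n \<Longrightarrow> prob_space (\<mu> n)" and sets: "\<And>n. sets (\<mu> n) = sets borel"
    and conc: "\<And>\<delta>. 0 < \<delta> \<Longrightarrow> (\<lambda>n. measure (\<mu> n) {s. \<delta> \<le> \<bar>s - q\<bar>}) \<longlonglongrightarrow> 0"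
    and [measurable]: "\<And>n. h n \<in> borel_measurable borel" and B: "\<And>n s. \<bar>h n s\<bar> \<le> B"
    and h: "((\<lambda>(n, s). h n s) \<longlongrightarrow> L) (sequentially \<times>\<^sub>F nhds q)"
  shows "(\<lambda>n. \<integral>s. h n s \<partial>\<mu> n) \<longlonglongrightarrow> L"
proof (rule tendstoI)
  fix e :: real assume e: "0 < e"
  from tendstoD[OF h, of "e / 2"] e obtain P Q where PQ: "eventually P sequentially" "eventually Q (nhds q)"
    "\<And>n s. P n \<Longrightarrow> Q s \<Longrightarrow> \<bar>h n s - L\<bar> < e / 2"
    by (auto simp: eventually_prod_filter dist_real_def)
  from PQ(2) obtain \<delta> where \<delta>: "0 < \<delta>" "\<And>s. \<bar>s - q\<bar> < \<delta> \<Longrightarrow> Q s"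
    by (auto simp: eventually_nhds_metric dist_real_def)
  have "(\<lambda>n. (B + \<bar>L\<bar>) * measure (\<mu> n) {s. \<delta> \<le> \<bar>s - q\<bar>}) \<longlonglongrightarrow> (B + \<bar>L\<bar>) * 0"
    by (intro tendsto_intros conc \<delta>)
  then have "\<forall>\<^sub>F n in sequentially. (B + \<bar>L\<bar>) * measure (\<mu> n) {s. \<delta> \<le> \<bar>s - q\<bar>} < e / 2"
    by (rule order_tendstoD) (use e in simp)
  then show "\<forall>\<^sub>F n in sequentially. dist (\<integral>s. h n s \<partial>\<mu> n) L < e"
    using PQ(1) eventually_gt_at_top[of 0]
  proof eventually_elim
    case (elim n)
    interpret prob_space "\<mu> n" by (rule \<mu>) (rule elim)
    have [measurable_cong]: "sets (\<mu> n) = sets borel" by (rule sets)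
    have sp: "space (\<mu> n) = UNIV" using sets_eq_imp_space_eq[OF sets] by simp
    let ?A = "{s. \<delta> \<le> \<bar>s - q\<bar>}"
    have A[measurable]: "?A \<in> sets borel" by measurable
    have int: "integrable (\<mu> n) (h n)"
      by (rule integrable_const_bound[where B = B]) (use B in auto)
    have "\<bar>(\<integral>s. h n s \<partial>\<mu> n) - L\<bar> = \<bar>\<integral>s. h n s - L \<partial>\<mu> n\<bar>"
      using int by (simp add: prob_space)
    also have "\<dots> \<le> (\<integral>s. \<bar>h n s - L\<bar> \<partial>\<mu> n)"
      by (rule integral_abs_bound)
    also have "\<dots> \<le> (\<integral>s. e / 2 + (B + \<bar>L\<bar>) * indicator ?A s \<partial>\<mu> n)"
    proof (rule integral_mono)
      show "integrable (\<mu> n) (\<lambda>s. \<bar>h n s - L\<bar>)" using int by auto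
      show "integrable (\<mu> n) (\<lambda>s. e / 2 + (B + \<bar>L\<bar>) * indicator ?A s)"
        by (intro Bochner_Integration.integrable_add integrable_mult_right integrable_real_indicator) (auto simp: less_top[symmetric])
      show "\<bar>h n s - L\<bar> \<le> e / 2 + (B + \<bar>L\<bar>) * indicator ?A s" for s
      proof (cases "s \<in> ?A")
        case True
        then show ?thesis using B[of n s] e by (simp add: indicator_def)
      next
        case False
        then show ?thesis using PQ(3)[OF elim(2) \<delta>(2), of s] by (simp add: indicator_def)
      qed
    qed
    also have "\<dots> = e / 2 + (B + \<bar>L\<bar>) * prob ?A"
      using A prob_space by (simp add: sp less_top[symmetric])
    also have "\<dots> < e" using elim(1) by simp
    finally show ?case by (simp add: dist_real_def)
  qed
qed

lemma diagonal_sequence: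
  fixes P :: "nat \<Rightarrow> nat \<Rightarrow> bool"
  assumes P: "\<And>k. eventually (P k) sequentially"
  shows "\<exists>\<kappa>. filterlim \<kappa> at_top sequentially \<and> (\<forall>\<^sub>F n in sequentially. P (\<kappa> n) n)"
proof -
  from P have "\<exists>N. \<forall>k. \<forall>n\<ge>N k. P k n"
    unfolding eventually_sequentially by (rule choice[OF allI])
  then obtain N where N: "\<And>k n. N k \<le> n \<Longrightarrow> P k n" by blast
  \<comment> \<open>The largest index whose threshold has been passed. The bound
    \<open>k \<le> n\<close> makes the set finite and the exemption of 0 makes it nonempty; at index
    0 the property is only claimed once \<open>N 0 \<le> n\<close>.\<close>
  define \<kappa> where "\<kappa> n = Max {k. k \<le> n \<and> (k = 0 \<or> N k \<le> n)}" for n :: nat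
  have fin: "finite {k. k \<le> n \<and> (k = 0 \<or> N k \<le> n)}" for n by (rule finite_subset[of _ "{..n}"]) auto
  have mem: "\<kappa> n \<in> {k. k \<le> n \<and> (k = 0 \<or> N k \<le> n)}" for n
    unfolding \<kappa>_def by (rule Max_in[OF fin]) auto
  have ge: "k \<le> \<kappa> n" if "k \<le> n" "N k \<le> n" for k n
    unfolding \<kappa>_def using that by (intro Max_ge[OF fin]) auto
  have "filterlim \<kappa> at_top sequentially"
    unfolding filterlim_at_top
  proof
    fix k show "\<forall>\<^sub>F n in sequentially. k \<le> \<kappa> n"
      using ge[of k] by (auto simp: eventually_sequentially intro!: exI[of _ "max k (N k)"])
  qed
  moreover have "\<forall>\<^sub>F n in sequentially. P (\<kappa> n) n"
    using eventually_ge_at_top[of "N 0"]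
  proof eventually_elim
    case (elim n)
    then show ?case using mem[of n] N by (cases "\<kappa> n = 0") auto
  qed
  ultimately show ?thesis by blast
qed

text \<open>Sine and cosine are bounded and continuous, so the characteristic functions agree and
  Levy's uniqueness theorem applies.\<close>

lemma eq_if_integral_bounded_continuous_eq:
  fixes \<mu> \<nu> :: "real measure"
  assumes "prob_space \<mu>" "sets \<mu> = sets borel" "prob_space \<nu>" "sets \<nu> = sets borel"
    and eq: "\<And>f :: real \<Rightarrow> real. continuous_on UNIV f \<Longrightarrow> bounded (range f) \<Longrightarrow> (\<integral>x. f x \<partial>\<mu>) = (\<integral>x. f x \<partial>\<nu>)"
  shows "\<mu> = \<nu>"
proof -
  have rd: "real_distribution \<mu>" "real_distribution \<nu>"
    using assms(1-4) by (auto simp: real_distribution_def real_distribution_axioms_def)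
  have "char \<mu> t = char \<nu> t" for t
  proof -
    have c: "char M t = Complex (\<integral>x. cos (t * x) \<partial>M) (\<integral>x. sin (t * x) \<partial>M)" if "real_distribution M" for M
    proof -
      interpret real_distribution M by fact
      have "integrable M (\<lambda>x. iexp (t * x))" by (rule integrable_iexp) auto
      then show ?thesis
        unfolding char_def complex_eq_iff
        by (auto simp: integral_Re[symmetric] integral_Im[symmetric] Re_exp Im_exp simp del: of_real_mult)
    qed
    have "(\<integral>x. cos (t * x) \<partial>\<mu>) = (\<integral>x. cos (t * x) \<partial>\<nu>)" "(\<integral>x. sin (t * x) \<partial>\<mu>) = (\<integral>x. sin (t * x) \<partial>\<nu>)"
      by (intro eq continuous_intros boundedI[of _ 1]; auto)+
    then show ?thesis using c rd by simp
  qed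
  then show ?thesis using rd by (intro Levy_uniqueness) auto
qed

section \<open>Laplace's method for the initial magnetisation\<close>

text \<open>Mean of the first spin given the hidden initial magnetisation \<open>s\<close> and the
  magnetisation \<open>a\<close> of the other evolved spins, under the Gaussian reference law;
  \<open>spin_var\<close> is the corresponding variance.\<close>

definition spin_mean :: "real \<Rightarrow> nat \<Rightarrow> real \<Rightarrow> real \<Rightarrow> real" where
  "spin_mean t n a s = (real n * (1 + t) * s - (real n - 1) * a) / (1 + t * real n)"

definition spin_var :: "real \<Rightarrow> nat \<Rightarrow> real" where
  "spin_var t n = t * real n * (1 + t) / (1 + t * real n)"

text \<open>The quadratic part is minus the exponent of the Gaussian law of the hidden magnetisation
  given the other \<open>n - 1\<close> evolved spins, with the first one integrated out;
  \<open>V\<close> contributes the Boltzmann factor.\<close>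

definition energy :: "(real \<Rightarrow> real) \<Rightarrow> real \<Rightarrow> nat \<Rightarrow> real \<Rightarrow> real \<Rightarrow> real" where
  "energy V t n a s = real n * V s +
     (real n)\<^sup>2 * (1 + t) / (2 * (1 + t * real n)) * (s - (real n - 1) * a / (real n * (1 + t)))\<^sup>2"

definition posterior :: "(real \<Rightarrow> real) \<Rightarrow> real \<Rightarrow> nat \<Rightarrow> real \<Rightarrow> real measure" where
  "posterior V t n a = density lborel
     (\<lambda>s. ennreal (exp (- energy V t n a s) / (\<integral>s. exp (- energy V t n a s) \<partial>lborel)))"

definition objective :: "(real \<Rightarrow> real) \<Rightarrow> real \<Rightarrow> real \<Rightarrow> real \<Rightarrow> real" where
  "objective V t \<alpha> s = V s + s\<^sup>2 / 2 + (s - \<alpha>)\<^sup>2 / (2 * t)"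

section \<open>Mixture over the hidden magnetisation\<close>

context mean_field
begin

lemma spin_var_pos: "0 < n \<Longrightarrow> 0 < spin_var t n"
  using t_pos by (simp add: spin_var_def add_pos_pos)

lemma measurable_energy [measurable]: "energy V t n a \<in> borel_measurable borel"
  unfolding energy_def[abs_def] by measurable

lemma integrable_exp_energy:
  assumes n: "0 < n"
  shows "integrable lborel (\<lambda>s. exp (- energy V t n a s))"
proof (rule Bochner_Integration.integrable_bound)
  let ?c = "(real n)\<^sup>2 * (1 + t) / (2 * (1 + t * real n))"
  show "integrable lborel (\<lambda>s. exp (- (?c * (s - (real n - 1) * a / (real n * (1 + t)))\<^sup>2)))"
    using n t_pos by (intro integrable_exp_neg_square) (simp add: add_pos_pos)
  show "AE s in lborel. norm (exp (- energy V t n a s)) \<le>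
      norm (exp (- (?c * (s - (real n - 1) * a / (real n * (1 + t)))\<^sup>2)))"
    using V_nonneg by (auto simp: energy_def)
qed measurable

text \<open>The first spin, given the others, is a Gaussian mixture over the hidden initial magnetisation
  \<^term>\<open>s\<close>, whose law is the \<^const>\<open>posterior\<close>: this is the Gaussian Bayes formula once more.\<close>

lemma tilted_integral_eq_mixture:
  assumes n: "0 < n" and f[measurable]: "f \<in> borel_measurable borel" and B: "\<And>x. \<bar>f x\<bar> \<le> B"
  shows "tilted_integral V t n a f =
    1 / sqrt (2 * pi * ((1 + t * real n) / ((real n)\<^sup>2 * (1 + t)))) *
    (\<integral>s. exp (- energy V t n a s) * (\<integral>x. f x \<partial>normal_distr (spin_mean t n a s) (spin_var t n)) \<partial>lborel)"
proof -
  \<comment> \<open>Given the first spin \<open>x\<close>, the hidden magnetisation has mean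
    \<open>k * x + b\<close> and variance \<open>v2\<close>, as read off \<open>tilt\<close>.
    Integrating out \<open>x\<close>, which has variance \<open>1 + t\<close>, leaves mean
    \<open>b\<close> and variance \<open>w\<close>.\<close>
  define k where "k = 1 / (real n * (1 + t))"
  define b where "b = (real n - 1) * a / (real n * (1 + t))"
  define v2 where "v2 = t / ((1 + t) * real n)"
  define w where "w = (1 + t * real n) / ((real n)\<^sup>2 * (1 + t))"
  have t1: "0 < 1 + t" "0 < 1 + t * real n" using t_pos by (auto simp: add_pos_nonneg)
  have v2: "0 < v2" unfolding v2_def by (rule tilt_variance_pos[OF n])
  have w: "0 < w" using n t1 by (simp add: w_def)
  have "(1 / (N * u))\<^sup>2 * u + t / (u * N) = (1 + t * N) / (N\<^sup>2 * u)" if "0 < N" "0 < u" for N u :: real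
    using that by (simp add: field_simps power2_eq_square)
  then have w_eq: "k\<^sup>2 * (1 + t) + v2 = w"
    using n t1 by (simp add: k_def v2_def w_def)
  have mean_eq: "(1 + t) * k * (s - b) / w = spin_mean t n a s" for s
  proof -
    have 1: "(1 + t) * k * (s - b) = (s - b) / real n" using n t1 by (simp add: k_def)
    have 2: "s - b = (real n * (1 + t) * s - (real n - 1) * a) / (real n * (1 + t))"
      using n t1 by (simp add: b_def diff_divide_distrib)
    have 3: "(1 + t) * k * (s - b) = (real n * (1 + t) * s - (real n - 1) * a) / (real n * (1 + t)) / real n"
      by (rule trans[OF 1]) (simp only: 2)
    show ?thesis
      unfolding 3 using n t1 by (simp add: w_def spin_mean_def power2_eq_square)
  qed
  have var_eq: "(1 + t) * v2 / w = spin_var t n"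
  proof -
    have "(1 + t) * v2 = t / real n" using n t1 by (simp add: v2_def)
    then show ?thesis using n t1 by (simp add: w_def spin_var_def power2_eq_square)
  qed
  have arg_eq: "(x + (real n - 1) * a) / real n / (1 + t) = k * x + b" for x
    by (simp add: k_def b_def add_divide_distrib)
  have dens: "normal_density b (sqrt w) s * exp (- (real n * V s)) = 1 / sqrt (2 * pi * w) * exp (- energy V t n a s)" for s
  proof -
    have "1 / (2 * w) = (real n)\<^sup>2 * (1 + t) / (2 * (1 + t * real n))" by (simp add: w_def)
    then have "energy V t n a s = real n * V s + 1 / (2 * w) * (s - b)\<^sup>2"
      unfolding energy_def b_def by simp
    then have "exp (- energy V t n a s) = exp (- ((s - b)\<^sup>2 / (2 * w))) * exp (- (real n * V s))"
      by (simp flip: exp_add)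
    then show ?thesis
      using w by (simp add: normal_density_def)
  qed
  define F where "F = (\<lambda>x s. normal_density 0 (sqrt (1 + t)) x * normal_density (k * x + b) (sqrt v2) s * (f x * exp (- (real n * V s))))"
  have F_meas[measurable]: "case_prod F \<in> borel_measurable (lborel \<Otimes>\<^sub>M lborel)"
    unfolding F_def normal_density_def by measurable
  have B0: "0 \<le> B" using B[of 0] by linarith
  have nn1: "(\<integral>\<^sup>+x. ennreal (normal_density m (sqrt v) x) \<partial>lborel) = 1" if "0 < v" for m v
    using nn_integral_normal_distr[of "\<lambda>_. 1" m v] prob_space.emeasure_space_1[OF prob_space_normal_distr[OF that]] by simp
  \<comment> \<open>The Boltzmann factor is at most 1 and \<open>f\<close> at most \<open>B\<close>,
    so \<open>F\<close> is dominated by \<open>B\<close> times a joint probability density.\<close>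
  have "integrable (lborel \<Otimes>\<^sub>M lborel) (case_prod F)"
  proof (rule integrableI_bounded)
    have "(\<integral>\<^sup>+p. ennreal (norm (case_prod F p)) \<partial>(lborel \<Otimes>\<^sub>M lborel)) =
      (\<integral>\<^sup>+x. \<integral>\<^sup>+s. ennreal (norm (F x s)) \<partial>lborel \<partial>lborel)"
      by (subst lborel.nn_integral_fst[symmetric]) auto
    also have "\<dots> \<le> (\<integral>\<^sup>+x. \<integral>\<^sup>+s. ennreal B * (ennreal (normal_density 0 (sqrt (1 + t)) x) * ennreal (normal_density (k * x + b) (sqrt v2) s)) \<partial>lborel \<partial>lborel)"
    proof (intro nn_integral_mono)
      fix x s
      have "\<bar>f x\<bar> * exp (- (real n * V s)) \<le> B * 1"
        using B[of x] V_nonneg[of s] by (intro mult_mono) auto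
      then have "normal_density 0 (sqrt (1 + t)) x * normal_density (k * x + b) (sqrt v2) s * (\<bar>f x\<bar> * exp (- (real n * V s)))
         \<le> normal_density 0 (sqrt (1 + t)) x * normal_density (k * x + b) (sqrt v2) s * B"
        by (intro mult_left_mono) simp_all
      then show "ennreal (norm (F x s)) \<le> ennreal B * (ennreal (normal_density 0 (sqrt (1 + t)) x) * ennreal (normal_density (k * x + b) (sqrt v2) s))"
        using B0 by (simp add: F_def abs_mult ennreal_mult'[symmetric] ac_simps)
    qed
    also have "\<dots> = ennreal B"
      using nn1[OF t1(1)] nn1[OF v2] by (simp add: nn_integral_cmult)
    finally show "(\<integral>\<^sup>+p. ennreal (norm (case_prod F p)) \<partial>(lborel \<Otimes>\<^sub>M lborel)) < \<infinity>"
      by (rule le_less_trans) simp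
  qed measurable
  note Fubini = lborel_pair.Fubini_integral[OF this]
  have m1: "(\<lambda>x. f x * tilt V t n ((x + (real n - 1) * a) / real n)) \<in> borel_measurable borel"
    using measurable_tilt[OF n] by measurable
  have "tilted_integral V t n a f =
    (\<integral>x. normal_density 0 (sqrt (1 + t)) x * (f x * (\<integral>s. normal_density (k * x + b) (sqrt v2) s * exp (- (real n * V s)) \<partial>lborel)) \<partial>lborel)"
    unfolding tilted_integral_def integral_normal_distr[OF m1]
    unfolding tilt_def arg_eq v2_def[symmetric] by (subst integral_normal_distr) auto
  also have "\<dots> = (\<integral>x. \<integral>s. F x s \<partial>lborel \<partial>lborel)"
    unfolding F_def by (intro Bochner_Integration.integral_cong refl) (simp only: integral_mult_right_zero[symmetric] ac_simps)
  also have "\<dots> = (\<integral>s. \<integral>x. F x s \<partial>lborel \<partial>lborel)"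
    by (rule Fubini[symmetric])
  also have "\<dots> = (\<integral>s. 1 / sqrt (2 * pi * w) * (exp (- energy V t n a s) * (\<integral>x. f x \<partial>normal_distr (spin_mean t n a s) (spin_var t n))) \<partial>lborel)"
  proof (intro Bochner_Integration.integral_cong refl)
    fix s
    have "F x s = (normal_density b (sqrt w) s * exp (- (real n * V s))) * (normal_density (spin_mean t n a s) (sqrt (spin_var t n)) x * f x)" for x
      unfolding F_def normal_density_bayes[OF t1(1) v2] w_eq mean_eq var_eq by (simp only: ac_simps)
    then have "(\<integral>x. F x s \<partial>lborel) = (normal_density b (sqrt w) s * exp (- (real n * V s))) *
        (\<integral>x. normal_density (spin_mean t n a s) (sqrt (spin_var t n)) x * f x \<partial>lborel)"
      by simp
    then show "(\<integral>x. F x s \<partial>lborel) = 1 / sqrt (2 * pi * w) * (exp (- energy V t n a s) * (\<integral>x. f x \<partial>normal_distr (spin_mean t n a s) (spin_var t n)))"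
      unfolding dens integral_normal_distr[OF f] by (simp only: mult.assoc)
  qed
  also have "\<dots> = 1 / sqrt (2 * pi * w) * (\<integral>s. exp (- energy V t n a s) * (\<integral>x. f x \<partial>normal_distr (spin_mean t n a s) (spin_var t n)) \<partial>lborel)"
    by (rule integral_mult_right_zero)
  finally show ?thesis unfolding w_def .
qed

text \<open>By the mixture formula for the constant function 1, this normaliser is a factor of the
  positive number \<open>tilted_integral V t n a (\<lambda>_. 1)\<close>, the other factor being
  nonnegative.\<close>

lemma integral_exp_energy_pos:
  assumes n: "0 < n"
  shows "0 < (\<integral>s. exp (- energy V t n a s) \<partial>lborel)"
proof -
  have "(\<integral>x. (1::real) \<partial>normal_distr (spin_mean t n a s) (spin_var t n)) = 1" for s
    using prob_space.prob_space[OF prob_space_normal_distr[OF spin_var_pos[OF n]]] by simp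
  then have "0 < 1 / sqrt (2 * pi * ((1 + t * real n) / ((real n)\<^sup>2 * (1 + t)))) * (\<integral>s. exp (- energy V t n a s) \<partial>lborel)"
    using tilted_integral_1_pos[OF n, of a] by (simp add: tilted_integral_eq_mixture[OF n, of "\<lambda>_. 1" 1])
  moreover have "0 \<le> 1 / sqrt (2 * pi * ((1 + t * real n) / ((real n)\<^sup>2 * (1 + t))))"
    using t_pos by simp
  ultimately show ?thesis by (simp add: zero_less_mult_iff zero_less_divide_iff)
qed

lemma sets_posterior [simp, measurable_cong]: "sets (posterior V t n a) = sets borel"
  by (simp add: posterior_def)

lemma space_posterior [simp]: "space (posterior V t n a) = UNIV"
  by (simp add: posterior_def)

lemma prob_space_posterior:
  assumes n: "0 < n" shows "prob_space (posterior V t n a)"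
proof (rule prob_spaceI)
  let ?Z = "\<integral>s. exp (- energy V t n a s) \<partial>lborel"
  have "emeasure (posterior V t n a) (space (posterior V t n a)) = (\<integral>\<^sup>+s. ennreal (exp (- energy V t n a s) / ?Z) \<partial>lborel)"
    unfolding posterior_def by (subst emeasure_density) auto
  also have "\<dots> = ennreal (\<integral>s. exp (- energy V t n a s) / ?Z \<partial>lborel)"
    using integral_exp_energy_pos[OF n, of a]
    by (intro nn_integral_eq_integral integrable_divide integrable_exp_energy n) auto
  also have "\<dots> = 1" using integral_exp_energy_pos[OF n, of a] by simp
  finally show "emeasure (posterior V t n a) (space (posterior V t n a)) = 1" .
qed

lemma integral_posterior:
  assumes n: "0 < n" and [measurable]: "h \<in> borel_measurable borel"
  shows "(\<integral>s. h s \<partial>posterior V t n a) =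
    (\<integral>s. exp (- energy V t n a s) * h s \<partial>lborel) / (\<integral>s. exp (- energy V t n a s) \<partial>lborel)"
proof -
  let ?Z = "\<integral>s. exp (- energy V t n a s) \<partial>lborel"
  have "(\<integral>s. h s \<partial>posterior V t n a) = (\<integral>s. (exp (- energy V t n a s) / ?Z) *\<^sub>R h s \<partial>lborel)"
    unfolding posterior_def using integral_exp_energy_pos[OF n, of a] by (intro integral_density) auto
  also have "\<dots> = (\<integral>s. exp (- energy V t n a s) * h s / ?Z \<partial>lborel)"
    by simp
  finally show ?thesis by simp
qed

text \<open>The mixture formula for \<open>f\<close> is divided by the one for 1, which cancels the
  Gaussian prefactor. The standardised form leaves \<open>s\<close> only inside the integrand,
  whence continuity and so measurability in \<open>s\<close>.\<close>

lemma integral_cond_kernel_eq_posterior: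
  fixes f :: "real \<Rightarrow> real"
  assumes n: "0 < n" and f: "continuous_on UNIV f" "bounded (range f)"
  shows "(\<integral>x. f x \<partial>cond_kernel V t n a) =
    (\<integral>s. (\<integral>x. f (spin_mean t n a s + sqrt (spin_var t n) * x) \<partial>std_normal_distribution) \<partial>posterior V t n a)"
proof -
  obtain B where B: "\<And>x. \<bar>f x\<bar> \<le> B" using f(2) by (auto simp: bounded_iff)
  have fm[measurable]: "f \<in> borel_measurable borel" using f(1) by (rule borel_measurable_continuous_onI)
  let ?C = "1 / sqrt (2 * pi * ((1 + t * real n) / ((real n)\<^sup>2 * (1 + t))))"
  have one: "(\<integral>x. (1::real) \<partial>normal_distr (spin_mean t n a s) (spin_var t n)) = 1" for s
    using prob_space.prob_space[OF prob_space_normal_distr[OF spin_var_pos[OF n]]] by simp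
  have "1 + t * real n > 0" using t_pos by (simp add: add_pos_nonneg)
  note D = this
  then have C: "?C \<noteq> 0" using n t_pos by simp
  have norm: "tilted_integral V t n a (\<lambda>_. 1) = ?C * (\<integral>s. exp (- energy V t n a s) \<partial>lborel)"
    using tilted_integral_eq_mixture[OF n borel_measurable_const eq_refl[OF abs_one], of a]
    unfolding one mult_1_right .
  have "(\<integral>x. f x \<partial>cond_kernel V t n a) =
    (\<integral>s. exp (- energy V t n a s) * (\<integral>x. f x \<partial>normal_distr (spin_mean t n a s) (spin_var t n)) \<partial>lborel) /
    (\<integral>s. exp (- energy V t n a s) \<partial>lborel)"
    unfolding integral_cond_kernel[OF n fm] tilted_integral_eq_mixture[OF n fm B] norm
    using C by (rule mult_divide_mult_cancel_left)
  also have "\<dots> = (\<integral>s. (\<integral>x. f x \<partial>normal_distr (spin_mean t n a s) (spin_var t n)) \<partial>posterior V t n a)"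
  proof (rule integral_posterior[OF n, symmetric])
    show "(\<lambda>s. \<integral>x. f x \<partial>normal_distr (spin_mean t n a s) (spin_var t n)) \<in> borel_measurable borel"
      unfolding integral_normal_distr_standardise[OF spin_var_pos[OF n] fm] spin_mean_def
      by (intro borel_measurable_continuous_onI, unfold continuous_on_def)
        (intro ballI tendsto_normal_average f tendsto_intros, use D in auto)
  qed
  finally show ?thesis
    unfolding integral_normal_distr_standardise[OF spin_var_pos[OF n] fm] .
qed

text \<open>Completing the square gives the objective the shape of \<open>energy\<close> divided by
  \<open>n\<close>: the coefficient \<open>(1 + t) / (2 * t)\<close> and the centre
  \<open>\<alpha> / (1 + t)\<close> are the limits of those found there, and the last term does not
  depend on \<open>s\<close>.\<close>

lemma objective_eq:
  "objective V t \<alpha> s = V s + (1 + t) / (2 * t) * (s - \<alpha> / (1 + t))\<^sup>2 + \<alpha>\<^sup>2 / (2 * (1 + t))"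
proof -
  have "s\<^sup>2 / 2 + (s - \<alpha>)\<^sup>2 / (2 * t) = u / (2 * t) * (s - \<alpha> / u)\<^sup>2 + \<alpha>\<^sup>2 / (2 * u)"
    if u: "0 < u" "u = 1 + t" for u
  proof -
    have "u / (2 * t) * (s - \<alpha> / u)\<^sup>2 = (u * s - \<alpha>)\<^sup>2 / (2 * t * u)"
      using u(1) t_pos by (simp add: field_simps power2_eq_square)
    also have "\<dots> + \<alpha>\<^sup>2 / (2 * u) = ((u * s - \<alpha>)\<^sup>2 + t * \<alpha>\<^sup>2) / (2 * t * u)"
      using u(1) t_pos by (simp add: field_simps)
    also have "(u * s - \<alpha>)\<^sup>2 + t * \<alpha>\<^sup>2 = u * (t * s\<^sup>2 + (s - \<alpha>)\<^sup>2)"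
      unfolding u(2) by (simp add: power2_eq_square algebra_simps)
    also have "\<dots> / (2 * t * u) = s\<^sup>2 / 2 + (s - \<alpha>)\<^sup>2 / (2 * t)"
      using u(1) t_pos by (simp add: field_simps)
    finally show ?thesis by simp
  qed
  from this[OF one_plus_t_pos refl] show ?thesis by (simp add: objective_def)
qed

text \<open>Laplace's method. The energy per spin converges to the objective locally uniformly, which bounds
  the normaliser from below; a small multiple of the quadratic part is spared to keep the upper bound
  integrable.\<close>

lemma posterior_tendsto_0:
  assumes a: "a \<longlonglongrightarrow> \<alpha>" and C[measurable]: "C \<in> sets borel" and \<eta>: "0 < \<eta>"
    and gap: "\<And>s. s \<in> C \<Longrightarrow> objective V t \<alpha> q + \<eta> \<le> objective V t \<alpha> s"
  shows "(\<lambda>n. measure (posterior V t n (a n)) C) \<longlonglongrightarrow> 0"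
proof -
  define c where "c = (1 + t) / (2 * t)"
  define b where "b = \<alpha> / (1 + t)"
  define G where "G = (\<lambda>s. V s + c * (s - b)\<^sup>2)"
  define r where "r = (\<lambda>n. t * real n / (1 + t * real n))"
  define d where "d = (\<lambda>n. (real n - 1) * a n / (real n * (1 + t)))"
  have c: "0 < c" using t_pos by (simp add: c_def)
  have G0: "0 \<le> G s" for s using c V_nonneg by (simp add: G_def)
  have gapG: "G q + \<eta> \<le> G s" if "s \<in> C" for s
    using gap[OF that] by (simp add: objective_eq G_def c_def b_def)
  \<comment> \<open>The dependence on \<open>n\<close> of the energy per spin is confined to
    \<open>r n\<close>, which tends to 1, and \<open>d n\<close>, which tends to
    \<open>b\<close>.\<close>
  have en: "energy V t n (a n) s = real n * (V s + c * r n * (s - d n)\<^sup>2)" for n s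
  proof -
    have "(real n)\<^sup>2 * u / (2 * D) = real n * (u / (2 * t) * (t * real n / D))" if "0 < D" for u D
      using that t_pos by (simp add: field_simps power2_eq_square)
    from this[of "1 + t * real n" "1 + t"]
    have "(real n)\<^sup>2 * (1 + t) / (2 * (1 + t * real n)) = real n * (c * r n)"
      using t_pos by (simp add: c_def r_def add_pos_nonneg)
    then show ?thesis unfolding energy_def d_def by (simp add: algebra_simps)
  qed
  have r: "r \<longlonglongrightarrow> 1" unfolding r_def using t_pos by real_asymp
  have d: "d \<longlonglongrightarrow> b"
  proof -
    have "(\<lambda>n. (real n - 1) / (real n * (1 + t))) \<longlonglongrightarrow> inverse (1 + t)" using t_pos by real_asymp
    from tendsto_mult[OF this a] show ?thesis by (simp add: d_def b_def field_class.field_divide_inverse ac_simps)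
  qed
  \<comment> \<open>Chosen so that \<open>(1 - 2 * \<epsilon>) * (G q + \<eta>) - \<epsilon> = G q +
    \<eta> / 2\<close>. One share of \<open>G s\<close> and the additive term absorb the errors of
    \<open>r\<close> and \<open>d\<close>; the other share pays for the quadratic term kept for
    integrability.\<close>
  define \<epsilon> where "\<epsilon> = \<eta> / 2 / (2 * (G q + \<eta>) + 1)"
  have den: "0 < 2 * (G q + \<eta>) + 1" using G0[of q] \<eta> by simp
  have \<epsilon>: "0 < \<epsilon>" "\<epsilon> < 1 / 2" "\<epsilon> * (2 * (G q + \<eta>) + 1) = \<eta> / 2"
  proof -
    show "0 < \<epsilon>" using \<eta> den by (simp add: \<epsilon>_def)
    show "\<epsilon> * (2 * (G q + \<eta>) + 1) = \<eta> / 2"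
      unfolding \<epsilon>_def by (rule nonzero_eq_divide_eq[THEN iffD1]) (use den in auto)
    show "\<epsilon> < 1 / 2" unfolding \<epsilon>_def using G0[of q] \<eta> den by (simp add: field_simps)
  qed
  have "(\<lambda>n. r n * (1 - \<bar>d n - b\<bar>)) \<longlonglongrightarrow> 1 * (1 - \<bar>b - b\<bar>)" by (intro tendsto_intros r d)
  then have ev1: "\<forall>\<^sub>F n in sequentially. 1 - \<epsilon> < r n * (1 - \<bar>d n - b\<bar>)"
    by (rule order_tendstoD) (use \<epsilon> in simp)
  have "(\<lambda>n. c * r n * \<bar>d n - b\<bar>) \<longlonglongrightarrow> c * 1 * \<bar>b - b\<bar>" by (intro tendsto_intros r d)
  then have ev2: "\<forall>\<^sub>F n in sequentially. c * r n * \<bar>d n - b\<bar> < \<epsilon>"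
    by (rule order_tendstoD) (use \<epsilon> in simp)
  have upper: "\<forall>\<^sub>F n in sequentially. \<forall>s\<in>C. real n * (G q + \<eta> / 2) + \<epsilon> * c * (s - b)\<^sup>2 \<le> energy V t n (a n) s"
    using ev1 ev2 eventually_ge_at_top[of 1]
  proof eventually_elim
    case (elim n)
    show ?case
    proof
      fix s assume s: "s \<in> C"
      let ?e = "\<bar>d n - b\<bar>" and ?x = "s - b"
      have r0: "0 \<le> r n" using t_pos by (simp add: r_def)
      \<comment> \<open>The cross term is absorbed by
        \<open>2 * \<bar>?x\<bar> \<le> ?x\<^sup>2 + 1\<close>, which makes the estimate uniform
        over the possibly unbounded set \<open>C\<close>.\<close>
      have "(1 - ?e) * ?x\<^sup>2 - ?e \<le> (s - d n)\<^sup>2"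
      proof -
        have "2 * \<bar>?x\<bar> \<le> ?x\<^sup>2 + 1"
          using sum_squares_bound[of "\<bar>?x\<bar>" 1] by simp
        then have "?e * (2 * \<bar>?x\<bar>) \<le> ?e * (?x\<^sup>2 + 1)" by (intro mult_left_mono) auto
        moreover have "2 * ?x * (d n - b) \<le> ?e * (2 * \<bar>?x\<bar>)"
        proof -
          have "\<bar>2 * ?x * (d n - b)\<bar> = ?e * (2 * \<bar>?x\<bar>)" by (simp only: abs_mult abs_numeral ac_simps)
          then show ?thesis using abs_ge_self[of "2 * ?x * (d n - b)"] by linarith
        qed
        moreover have "(s - d n)\<^sup>2 = ?x\<^sup>2 - 2 * ?x * (d n - b) + (d n - b)\<^sup>2"
          by (simp add: power2_eq_square algebra_simps)
        moreover have "?e * (?x\<^sup>2 + 1) = ?e * ?x\<^sup>2 + ?e" "(1 - ?e) * ?x\<^sup>2 = ?x\<^sup>2 - ?e * ?x\<^sup>2"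
          by (simp_all add: distrib_left left_diff_distrib)
        ultimately show ?thesis using zero_le_power2[of "d n - b"] by linarith
      qed
      then have "c * r n * ((1 - ?e) * ?x\<^sup>2 - ?e) \<le> c * r n * (s - d n)\<^sup>2"
        using c r0 by (intro mult_left_mono) auto
      moreover have "c * ?x\<^sup>2 * (1 - \<epsilon>) \<le> c * ?x\<^sup>2 * (r n * (1 - ?e))"
        using elim(1) c by (intro mult_left_mono) auto
      ultimately have "(1 - \<epsilon>) * (c * ?x\<^sup>2) - \<epsilon> \<le> c * r n * (s - d n)\<^sup>2"
        using elim(2) by (simp add: algebra_simps)
      moreover have "(1 - \<epsilon>) * V s \<le> V s" using \<epsilon> V_nonneg[of s] by (simp add: mult_left_le_one_le)
      ultimately have "(1 - \<epsilon>) * G s - \<epsilon> \<le> V s + c * r n * (s - d n)\<^sup>2"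
        unfolding G_def by (simp add: algebra_simps)
      moreover have "(1 - 2 * \<epsilon>) * (G q + \<eta>) \<le> (1 - 2 * \<epsilon>) * G s"
        using gapG[OF s] \<epsilon> by (intro mult_left_mono) auto
      moreover have "\<epsilon> * (c * ?x\<^sup>2) \<le> \<epsilon> * G s"
        using \<epsilon> V_nonneg[of s] by (intro mult_left_mono) (auto simp: G_def)
      moreover have "(1 - 2 * \<epsilon>) * (G q + \<eta>) - \<epsilon> = G q + \<eta> / 2"
        using \<epsilon>(3) by (simp add: algebra_simps)
      ultimately have *: "(G q + \<eta> / 2) + \<epsilon> * c * ?x\<^sup>2 \<le> V s + c * r n * (s - d n)\<^sup>2"
        by (simp add: algebra_simps)
      \<comment> \<open>Only one of the \<open>n\<close> copies of the spared quadratic term is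
        retained, so the dominating Gaussian integral \<open>?M\<close> does not depend on
        \<open>n\<close>.\<close>
      have "real n * (G q + \<eta> / 2) + 1 * (\<epsilon> * c * ?x\<^sup>2) \<le> real n * (G q + \<eta> / 2) + real n * (\<epsilon> * c * ?x\<^sup>2)"
        using elim(3) \<epsilon> c by (intro add_left_mono mult_right_mono) auto
      also have "\<dots> \<le> energy V t n (a n) s"
        unfolding en distrib_left[symmetric] using * by (intro mult_left_mono) auto
      finally show "real n * (G q + \<eta> / 2) + \<epsilon> * c * (s - b)\<^sup>2 \<le> energy V t n (a n) s" by simp
    qed
  qed
  have "((\<lambda>p. V (snd p) + c * r (fst p) * (snd p - d (fst p))\<^sup>2) \<longlongrightarrow> V q + c * 1 * (q - b)\<^sup>2) (sequentially \<times>\<^sub>F nhds q)"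
    by (intro tendsto_intros filterlim_snd filterlim_compose[OF r filterlim_fst] filterlim_compose[OF d filterlim_fst])
  then have "\<forall>\<^sub>F p in sequentially \<times>\<^sub>F nhds q. V (snd p) + c * r (fst p) * (snd p - d (fst p))\<^sup>2 < G q + \<eta> / 4"
    by (rule order_tendstoD) (use \<eta> in \<open>simp add: G_def\<close>)
  then obtain P Q where PQ: "eventually P sequentially" "eventually Q (nhds q)"
    "\<And>n s. P n \<Longrightarrow> Q s \<Longrightarrow> V s + c * r n * (s - d n)\<^sup>2 < G q + \<eta> / 4"
    by (auto simp: eventually_prod_filter)
  from PQ(2) obtain \<delta> where \<delta>: "0 < \<delta>" "\<And>s. \<bar>s - q\<bar> < \<delta> \<Longrightarrow> Q s"
    by (auto simp: eventually_nhds_metric dist_real_def)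
  let ?M = "\<integral>s. exp (- (\<epsilon> * c * (s - b)\<^sup>2)) \<partial>lborel"
  have M0: "0 \<le> ?M" by (intro integral_nonneg_AE) simp
  \<comment> \<open>The numerator decays at rate \<open>G q + \<eta> / 2\<close>, while the
    \<open>\<delta>\<close>-neighbourhood of \<open>q\<close> keeps the normaliser above rate
    \<open>G q + \<eta> / 4\<close>; the quotient decays at rate \<open>\<eta> / 4\<close>.\<close>
  have bound: "\<forall>\<^sub>F n in sequentially. norm (measure (posterior V t n (a n)) C) \<le> ?M / (2 * \<delta>) * exp (- (real n * (\<eta> / 4)))"
    using upper PQ(1) eventually_gt_at_top[of 0]
  proof eventually_elim
    case (elim n)
    let ?E = "energy V t n (a n)"
    have num: "(\<integral>s. exp (- ?E s) * indicator C s \<partial>lborel) \<le> exp (- (real n * (G q + \<eta> / 2))) * ?M"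
    proof -
      have "(\<integral>s. exp (- ?E s) * indicator C s \<partial>lborel) \<le> (\<integral>s. exp (- (real n * (G q + \<eta> / 2))) * exp (- (\<epsilon> * c * (s - b)\<^sup>2)) \<partial>lborel)"
      proof (rule integral_mono)
        show "integrable lborel (\<lambda>s. exp (- ?E s) * indicator C s)"
          by (rule integrable_real_mult_indicator[OF _ integrable_exp_energy]) (use elim in auto)
        show "integrable lborel (\<lambda>s. exp (- (real n * (G q + \<eta> / 2))) * exp (- (\<epsilon> * c * (s - b)\<^sup>2)))"
          using \<epsilon> c by (intro integrable_mult_right integrable_exp_neg_square) auto
        show "exp (- ?E s) * indicator C s \<le> exp (- (real n * (G q + \<eta> / 2))) * exp (- (\<epsilon> * c * (s - b)\<^sup>2))" for s
          using elim(1) unfolding exp_add[symmetric] by (cases "s \<in> C") auto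
      qed
      then show ?thesis by simp
    qed
    have denom: "2 * \<delta> * exp (- (real n * (G q + \<eta> / 4))) \<le> (\<integral>s. exp (- ?E s) \<partial>lborel)"
    proof -
      have "(\<integral>s. exp (- (real n * (G q + \<eta> / 4))) * indicator {q - \<delta><..<q + \<delta>} s \<partial>lborel) \<le> (\<integral>s. exp (- ?E s) \<partial>lborel)"
      proof (rule integral_mono)
        show "integrable lborel (\<lambda>s. exp (- (real n * (G q + \<eta> / 4))) * indicator {q - \<delta><..<q + \<delta>} s)"
          using \<delta>(1) by (intro integrable_mult_right integrable_real_indicator) auto
        show "integrable lborel (\<lambda>s. exp (- ?E s))" by (rule integrable_exp_energy[OF elim(3)])
        show "exp (- (real n * (G q + \<eta> / 4))) * indicator {q - \<delta><..<q + \<delta>} s \<le> exp (- ?E s)" for s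
        proof (cases "s \<in> {q - \<delta><..<q + \<delta>}")
          case True
          then have "V s + c * r n * (s - d n)\<^sup>2 < G q + \<eta> / 4"
            by (intro PQ(3) elim \<delta>(2)) auto
          then show ?thesis unfolding en using True by (auto intro!: mult_left_mono)
        qed simp
      qed
      then show ?thesis using \<delta>(1) by (simp add: mult.commute)
    qed
    have "measure (posterior V t n (a n)) C = (\<integral>s. indicator C s \<partial>posterior V t n (a n))"
      by simp
    also have "\<dots> = (\<integral>s. exp (- ?E s) * indicator C s \<partial>lborel) / (\<integral>s. exp (- ?E s) \<partial>lborel)"
      by (rule integral_posterior) (use elim in auto)
    also have "\<dots> \<le> (exp (- (real n * (G q + \<eta> / 2))) * ?M) / (2 * \<delta> * exp (- (real n * (G q + \<eta> / 4))))"
      using M0 \<delta>(1) by (intro frac_le num denom) auto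
    also have "\<dots> = ?M / (2 * \<delta>) * exp (- (real n * (\<eta> / 4)))"
    proof -
      have "- (real n * (G q + \<eta> / 2)) = - (real n * (\<eta> / 4)) + - (real n * (G q + \<eta> / 4))"
        by (simp add: algebra_simps)
      then have "exp (- (real n * (G q + \<eta> / 2))) = exp (- (real n * (\<eta> / 4))) * exp (- (real n * (G q + \<eta> / 4)))"
        by (simp only: exp_add)
      then show ?thesis by simp
    qed
    finally show ?case by simp
  qed
  have "(\<lambda>n. exp (- (real n * (\<eta> / 4)))) \<longlonglongrightarrow> 0" using \<eta> by real_asymp
  then have "(\<lambda>n. ?M / (2 * \<delta>) * exp (- (real n * (\<eta> / 4)))) \<longlonglongrightarrow> 0"
    by (rule tendsto_mult_right_zero)
  with bound show ?thesis by (rule Lim_null_comparison)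
qed

end

section \<open>Good magnetisations\<close>

context mean_field
begin

lemma continuous_objective: "continuous_on UNIV (objective V t \<alpha>)"
  unfolding objective_def[abs_def] using t_pos by (intro continuous_intros V_continuous) auto

lemma objective_ge: "s\<^sup>2 / 2 \<le> objective V t \<alpha> s"
  using V_nonneg[of s] t_pos by (simp add: objective_def)

lemma objective_minimiser_exists: "\<exists>q. \<forall>s. objective V t \<alpha> q \<le> objective V t \<alpha> s"
proof -
  let ?F = "objective V t \<alpha>"
  \<comment> \<open>Beyond this radius the lower bound \<open>s\<^sup>2 / 2\<close> already exceeds
    the value at 0.\<close>
  let ?R = "sqrt (2 * ?F 0)"
  have F0: "0 \<le> ?F 0" using objective_ge[of 0 \<alpha>] by simp
  have "\<exists>q\<in>cball 0 ?R. \<forall>s\<in>cball 0 ?R. ?F q \<le> ?F s"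
    using F0 by (intro continuous_attains_inf continuous_on_subset[OF continuous_objective]) auto
  then obtain q where "\<forall>s\<in>cball 0 ?R. ?F q \<le> ?F s" by blast
  then have q: "\<bar>s\<bar> \<le> ?R \<Longrightarrow> ?F q \<le> ?F s" for s by simp
  have "?F q \<le> ?F s" for s
  proof (cases "\<bar>s\<bar> \<le> ?R")
    case False
    then have "?R\<^sup>2 \<le> \<bar>s\<bar>\<^sup>2" using F0 by (intro power_mono) auto
    then have "?F 0 \<le> s\<^sup>2 / 2" using F0 by simp
    also have "\<dots> \<le> ?F s" by (rule objective_ge)
    finally show ?thesis using q[of 0] F0 by simp
  qed (rule q)
  then show ?thesis by blast
qed

text \<open>Uniqueness is a pointwise strict inequality, whereas Laplace's method needs a uniform
  one. Outside the radius \<open>?R\<close> coercivity yields gap 1; inside, the minimum over the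
  compact set \<open>?C\<close> is attained at some \<open>r\<close> different from
  \<open>q\<close>.\<close>

lemma objective_gap:
  assumes q: "\<And>r. (\<forall>s. objective V t \<alpha> r \<le> objective V t \<alpha> s) \<longleftrightarrow> r = q" and \<delta>: "0 < \<delta>"
  shows "\<exists>\<eta>>0. \<forall>s. \<delta> \<le> \<bar>s - q\<bar> \<longrightarrow> objective V t \<alpha> q + \<eta> \<le> objective V t \<alpha> s"
proof -
  let ?F = "objective V t \<alpha>"
  let ?R = "sqrt (2 * (?F q + 1))"
  let ?C = "cball 0 ?R \<inter> {s. \<delta> \<le> \<bar>s - q\<bar>}"
  have Fq: "0 \<le> ?F q" using objective_ge[of q \<alpha>] by (rule order_trans[rotated]) simp
  have min: "?F q \<le> ?F s" for s using q[of q] by simp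
  have out: "?F q + 1 \<le> ?F s" if "\<not> \<bar>s\<bar> \<le> ?R" for s
  proof -
    have "?R\<^sup>2 \<le> \<bar>s\<bar>\<^sup>2" using Fq that by (intro power_mono) auto
    then have "?F q + 1 \<le> s\<^sup>2 / 2" using Fq by simp
    also have "\<dots> \<le> ?F s" by (rule objective_ge)
    finally show ?thesis .
  qed
  show ?thesis
  proof (cases "?C = {}")
    case True
    have "?F q + 1 \<le> ?F s" if "\<delta> \<le> \<bar>s - q\<bar>" for s
      by (rule out) (use True that in auto)
    then show ?thesis by (intro exI[of _ 1]) auto
  next
    case False
    have "closed {s. \<delta> \<le> \<bar>s - q\<bar>}" by (intro closed_Collect_le continuous_intros)
    then have "\<exists>r\<in>?C. \<forall>s\<in>?C. ?F r \<le> ?F s"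
      using False by (intro continuous_attains_inf continuous_on_subset[OF continuous_objective] compact_Int_closed) auto
    then obtain r where r: "r \<in> ?C" "\<And>s. s \<in> ?C \<Longrightarrow> ?F r \<le> ?F s" by blast
    from r(1) \<delta> have "r \<noteq> q" by auto
    then have "?F r \<noteq> ?F q" using q[of r] min by auto
    with min[of r] have less: "?F q < ?F r" by simp
    show ?thesis
    proof (intro exI[of _ "min 1 (?F r - ?F q)"] conjI allI impI)
      show "0 < min 1 (?F r - ?F q)" using less by simp
      fix s assume "\<delta> \<le> \<bar>s - q\<bar>"
      then show "?F q + min 1 (?F r - ?F q) \<le> ?F s"
        using out[of s] r(2)[of s] by (cases "\<bar>s\<bar> \<le> ?R") auto
    qed
  qed
qed

lemma global_minimiser_rate_iff:
  "global_minimiser (rate V t \<alpha>) q \<longleftrightarrow> (\<forall>s. objective V t \<alpha> q \<le> objective V t \<alpha> s)"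
proof -
  have "rate V t \<alpha> r = objective V t \<alpha> r - (INF s. objective V t \<alpha> s)" for r
    by (simp add: rate_def objective_def)
  then show ?thesis by (auto simp: is_arg_min_def not_less)
qed

section \<open>Weak limit for a unique minimiser\<close>

lemma tendsto_spin_mean:
  assumes n: "filterlim n at_top F" and a: "(a \<longlongrightarrow> \<alpha>) F" and s: "(s \<longlongrightarrow> q) F"
  shows "((\<lambda>p. spin_mean t (n p) (a p) (s p)) \<longlongrightarrow> ((1 + t) * q - \<alpha>) / t) F"
proof -
  have "(\<lambda>k. real k / (1 + t * real k)) \<longlonglongrightarrow> inverse t" "(\<lambda>k. (real k - 1) / (1 + t * real k)) \<longlonglongrightarrow> inverse t"
    using t_pos by real_asymp+
  note ratios = this[THEN filterlim_compose, OF n]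
  have "((\<lambda>p. real (n p) / (1 + t * real (n p)) * ((1 + t) * s p) - (real (n p) - 1) / (1 + t * real (n p)) * a p)
      \<longlongrightarrow> inverse t * ((1 + t) * q) - inverse t * \<alpha>) F"
    by (intro tendsto_intros ratios a s)
  also have "inverse t * ((1 + t) * q) - inverse t * \<alpha> = ((1 + t) * q - \<alpha>) / t"
    by (simp add: divide_inverse algebra_simps)
  finally show ?thesis
    unfolding spin_mean_def diff_divide_distrib[of _ "_ * _"] by (simp add: mult.assoc)
qed

lemma tendsto_spin_var:
  assumes n: "filterlim n at_top F"
  shows "((\<lambda>p. spin_var t (n p)) \<longlongrightarrow> 1 + t) F"
proof -
  have "(\<lambda>k. spin_var t k) \<longlonglongrightarrow> 1 + t"
    unfolding spin_var_def using t_pos by real_asymp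
  from filterlim_compose[OF this n] show ?thesis .
qed

lemma measurable_normal_average:
  fixes f :: "real \<Rightarrow> real"
  assumes f: "continuous_on UNIV f" "bounded (range f)"
  shows "(\<lambda>s. \<integral>x. f (spin_mean t n a s + sqrt v * x) \<partial>std_normal_distribution) \<in> borel_measurable borel"
proof -
  have "1 + t * real n > 0" using t_pos by (simp add: add_pos_nonneg)
  note D = this
  show ?thesis
    unfolding spin_mean_def
    by (intro borel_measurable_continuous_onI, unfold continuous_on_def)
      (intro ballI tendsto_normal_average f tendsto_intros, use D in auto)
qed

lemma abs_normal_average_le:
  assumes f: "continuous_on UNIV f" and B: "\<And>x. \<bar>f x\<bar> \<le> B"
  shows "\<bar>\<integral>x. f (m + v * x) \<partial>std_normal_distribution\<bar> \<le> (B::real)"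
proof -
  have [measurable]: "f \<in> borel_measurable borel" using f by (rule borel_measurable_continuous_onI)
  have "\<bar>\<integral>x. f (m + v * x) \<partial>std_normal_distribution\<bar> \<le> (\<integral>x. \<bar>f (m + v * x)\<bar> \<partial>std_normal_distribution)"
    by (rule integral_abs_bound)
  also have "\<dots> \<le> B"
    by (intro std.integral_le_const std.integrable_const_bound[where B = B] AE_I2) (use B in auto)
  finally show ?thesis .
qed

text \<open>The inner Gaussian average converges jointly as \<open>n\<close> grows and
  \<open>s\<close> tends to \<open>q\<close>, and the posterior concentrates at \<open>q\<close>;
  mean and variance of the limit are those of \<open>spin_mean\<close> at \<open>q\<close> and of
  \<open>spin_var\<close>.\<close>

lemma cond_kernel_converges_weakly:
  assumes q: "\<And>r. (\<forall>s. objective V t \<alpha> r \<le> objective V t \<alpha> s) \<longleftrightarrow> r = q" and a: "a \<longlonglongrightarrow> \<alpha>"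
  shows "converges_weakly (\<lambda>n. cond_kernel V t n (a n)) (normal_distr (((1 + t) * q - \<alpha>) / t) (1 + t))"
  unfolding converges_weakly_def
proof (intro allI impI, elim conjE)
  fix f :: "real \<Rightarrow> real" assume f: "continuous_on UNIV f" "bounded (range f)"
  then obtain B where B: "\<And>x. \<bar>f x\<bar> \<le> B" by (auto simp: bounded_iff)
  have fm: "f \<in> borel_measurable borel" using f(1) by (rule borel_measurable_continuous_onI)
  let ?h = "\<lambda>n s. \<integral>x. f (spin_mean t n (a n) s + sqrt (spin_var t n) * x) \<partial>std_normal_distribution"
  have "(\<lambda>n. \<integral>s. ?h n s \<partial>posterior V t n (a n)) \<longlonglongrightarrow>
      (\<integral>x. f (((1 + t) * q - \<alpha>) / t + sqrt (1 + t) * x) \<partial>std_normal_distribution)"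
  proof (rule tendsto_integral_concentrating)
    show "(\<lambda>n. measure (posterior V t n (a n)) {s. \<delta> \<le> \<bar>s - q\<bar>}) \<longlonglongrightarrow> 0" if \<delta>: "0 < \<delta>" for \<delta>
    proof -
      obtain \<eta> where "0 < \<eta>" "\<And>s. \<delta> \<le> \<bar>s - q\<bar> \<Longrightarrow> objective V t \<alpha> q + \<eta> \<le> objective V t \<alpha> s"
        using objective_gap[OF q \<delta>] by blast
      then show ?thesis by (intro posterior_tendsto_0[OF a, where \<eta> = \<eta> and q = q]) auto
    qed
    have "filterlim fst at_top (sequentially \<times>\<^sub>F nhds q)" by (rule filterlim_fst)
    then show "((\<lambda>(n, s). ?h n s) \<longlongrightarrow> (\<integral>x. f (((1 + t) * q - \<alpha>) / t + sqrt (1 + t) * x) \<partial>std_normal_distribution))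
        (sequentially \<times>\<^sub>F nhds q)"
      unfolding case_prod_beta
      by (intro tendsto_normal_average f tendsto_spin_mean tendsto_spin_var filterlim_snd filterlim_compose[OF a])
  qed (use prob_space_posterior measurable_normal_average[OF f] abs_normal_average_le[OF f(1) B] in auto)
  moreover have "\<forall>\<^sub>F n in sequentially. (\<integral>s. ?h n s \<partial>posterior V t n (a n)) = (\<integral>x. f x \<partial>cond_kernel V t n (a n))"
    using eventually_gt_at_top[of 0] by eventually_elim (simp add: integral_cond_kernel_eq_posterior f)
  ultimately show "(\<lambda>n. \<integral>x. f x \<partial>cond_kernel V t n (a n)) \<longlonglongrightarrow> (\<integral>x. f x \<partial>normal_distr (((1 + t) * q - \<alpha>) / t) (1 + t))"
    unfolding integral_normal_distr_standardise[OF one_plus_t_pos fm] by (rule Lim_transform_eventually)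
qed

text \<open>The first-order condition \<open>deriv V q + q + (q - \<alpha>) / t = 0\<close>,
  rearranged.\<close>

lemma objective_minimiser_deriv:
  assumes q: "\<And>s. objective V t \<alpha> q \<le> objective V t \<alpha> s" and V: "V differentiable at q"
  shows "((1 + t) * q - \<alpha>) / t = - deriv V q"
proof -
  have "(V has_real_derivative deriv V q) (at q)"
    using V by (simp add: DERIV_deriv_iff_real_differentiable)
  then have "(objective V t \<alpha> has_real_derivative deriv V q + q + (q - \<alpha>) / t) (at q)"
    unfolding objective_def[abs_def] using t_pos by (auto intro!: derivative_eq_intros simp: field_simps)
  then have "deriv V q + q + (q - \<alpha>) / t = 0"
    by (rule DERIV_local_min[of _ _ _ 1]) (use q in auto)
  then show ?thesis using t_pos by (simp add: field_simps)
qed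

text \<open>Moving \<^term>\<open>\<alpha>\<close> by a small amount singles out one side of the set of minimisers; a diagonal
  sequence then approaches \<^term>\<open>\<alpha>\<close> so slowly that the posterior still concentrates on that side.\<close>

lemma posterior_tendsto_0_diagonal:
  assumes \<beta>: "\<beta> \<longlonglongrightarrow> \<alpha>" and P: "\<And>k. (\<lambda>n. measure (posterior V t n (\<beta> k)) C) \<longlonglongrightarrow> 0"
  shows "\<exists>a. a \<longlonglongrightarrow> \<alpha> \<and> (\<lambda>n. measure (posterior V t n (a n)) C) \<longlonglongrightarrow> 0"
proof -
  have "\<forall>\<^sub>F n in sequentially. measure (posterior V t n (\<beta> k)) C < 1 / real (Suc k)" for k
    using P[of k] by (rule order_tendstoD) simp
  from diagonal_sequence[of "\<lambda>k n. measure (posterior V t n (\<beta> k)) C < 1 / real (Suc k)", OF this]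
  obtain \<kappa> where \<kappa>: "filterlim \<kappa> at_top sequentially"
    "\<forall>\<^sub>F n in sequentially. measure (posterior V t n (\<beta> (\<kappa> n))) C < 1 / real (Suc (\<kappa> n))" by (elim exE conjE)
  have "(\<lambda>k. 1 / real (Suc k)) \<longlonglongrightarrow> 0" by real_asymp
  from filterlim_compose[OF this \<kappa>(1)] have "(\<lambda>n. 1 / real (Suc (\<kappa> n))) \<longlonglongrightarrow> 0" .
  moreover have "\<forall>\<^sub>F n in sequentially. norm (measure (posterior V t n (\<beta> (\<kappa> n))) C) \<le> 1 / real (Suc (\<kappa> n))"
    using \<kappa>(2) by eventually_elim simp
  ultimately have "(\<lambda>n. measure (posterior V t n (\<beta> (\<kappa> n))) C) \<longlonglongrightarrow> 0"
    by (rule Lim_null_comparison[rotated])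
  moreover have "(\<lambda>n. \<beta> (\<kappa> n)) \<longlonglongrightarrow> \<alpha>" by (rule filterlim_compose[OF \<beta> \<kappa>(1)])
  ultimately show ?thesis by blast
qed

text \<open>The parameter meets \<open>s\<close> only in the cross term
  \<open>- s * \<alpha> / t\<close>, so shifting it tilts the landscape linearly; raising it favours
  larger \<open>s\<close>.\<close>

lemma objective_shift:
  "objective V t \<beta> s - objective V t \<beta> q = objective V t \<alpha> s - objective V t \<alpha> q + (\<beta> - \<alpha>) * (q - s) / t"
proof -
  have "(s - \<beta>)\<^sup>2 - (q - \<beta>)\<^sup>2 = (s - \<alpha>)\<^sup>2 - (q - \<alpha>)\<^sup>2 + 2 * ((\<beta> - \<alpha>) * (q - s))"
    by (simp add: power2_eq_square algebra_simps)
  then have "((s - \<beta>)\<^sup>2 - (q - \<beta>)\<^sup>2) / (2 * t) = ((s - \<alpha>)\<^sup>2 - (q - \<alpha>)\<^sup>2) / (2 * t) + (\<beta> - \<alpha>) * (q - s) / t"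
    by (simp add: add_divide_distrib)
  then show ?thesis by (simp add: objective_def diff_divide_distrib)
qed

text \<open>Off \<open>C\<close> the Gaussian average at \<open>s\<close> is at least the one at the
  threshold \<open>c\<close>; on \<open>C\<close> it falls short by at most \<open>2 * B\<close>,
  and \<open>C\<close> loses its mass. Stating monotonicity relative to \<open>C\<close> covers an
  increasing \<open>f\<close> with a left half-line and a decreasing \<open>f\<close> with a right
  one.\<close>

lemma limit_ge_if_posterior_concentrates:
  fixes f :: "real \<Rightarrow> real"
  assumes f: "continuous_on UNIV f" and B: "\<And>x. \<bar>f x\<bar> \<le> B" and a: "a \<longlonglongrightarrow> \<alpha>"
    and C[measurable]: "C \<in> sets borel" and conc: "(\<lambda>n. measure (posterior V t n (a n)) C) \<longlonglongrightarrow> 0"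
    and mono: "\<And>n s x. s \<notin> C \<Longrightarrow> f (spin_mean t n (a n) c + x) \<le> f (spin_mean t n (a n) s + x)"
    and lim: "(\<lambda>n. \<integral>x. f x \<partial>cond_kernel V t n (a n)) \<longlonglongrightarrow> L"
  shows "(\<integral>x. f (((1 + t) * c - \<alpha>) / t + sqrt (1 + t) * x) \<partial>std_normal_distribution) \<le> L"
proof (rule tendsto_le[OF _ lim])
  have bd: "bounded (range f)" using B by (auto simp: bounded_iff)
  have [measurable]: "f \<in> borel_measurable borel" using f by (rule borel_measurable_continuous_onI)
  let ?h = "\<lambda>n s. \<integral>x. f (spin_mean t n (a n) s + sqrt (spin_var t n) * x) \<partial>std_normal_distribution"
  have hB: "\<bar>?h n s\<bar> \<le> B" for n s by (rule abs_normal_average_le[OF f B])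
  have "(\<lambda>n. ?h n c) \<longlonglongrightarrow> (\<integral>x. f (((1 + t) * c - \<alpha>) / t + sqrt (1 + t) * x) \<partial>std_normal_distribution)"
    by (intro tendsto_normal_average f bd tendsto_spin_mean tendsto_spin_var a tendsto_const filterlim_ident)
  from tendsto_diff[OF this tendsto_mult[OF tendsto_const[of "2 * B"] conc]]
  show "(\<lambda>n. ?h n c - 2 * B * measure (posterior V t n (a n)) C) \<longlonglongrightarrow>
    (\<integral>x. f (((1 + t) * c - \<alpha>) / t + sqrt (1 + t) * x) \<partial>std_normal_distribution)" by simp
  show "\<forall>\<^sub>F n in sequentially. ?h n c - 2 * B * measure (posterior V t n (a n)) C \<le> (\<integral>x. f x \<partial>cond_kernel V t n (a n))"
    using eventually_gt_at_top[of 0]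
  proof eventually_elim
    case (elim n)
    interpret P: prob_space "posterior V t n (a n)" by (rule prob_space_posterior[OF elim])
    have "?h n c - 2 * B * measure (posterior V t n (a n)) C = (\<integral>s. ?h n c - 2 * B * indicator C s \<partial>posterior V t n (a n))"
      using P.prob_space by (simp add: less_top[symmetric])
    also have "\<dots> \<le> (\<integral>s. ?h n s \<partial>posterior V t n (a n))"
    proof (rule integral_mono)
      show "integrable (posterior V t n (a n)) (\<lambda>s. ?h n c - 2 * B * indicator C s)"
        by (intro Bochner_Integration.integrable_diff integrable_mult_right integrable_real_indicator) (auto simp: less_top[symmetric])
      show "integrable (posterior V t n (a n)) (?h n)"
        using measurable_normal_average[OF f bd] hB by (intro P.integrable_const_bound[where B = B]) auto
      show "?h n c - 2 * B * indicator C s \<le> ?h n s" for s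
      proof (cases "s \<in> C")
        case True
        then show ?thesis using hB[of n c] hB[of n s] by simp
      next
        case False
        then have "?h n c \<le> ?h n s"
          by (intro integral_mono std.integrable_const_bound[where B = B]) (use B mono in auto)
        then show ?thesis using False by simp
      qed
    qed
    also have "\<dots> = (\<integral>x. f x \<partial>cond_kernel V t n (a n))"
      by (rule integral_cond_kernel_eq_posterior[OF elim f bd, symmetric])
    finally show ?case .
  qed
qed simp

text \<open>A common limit would satisfy \<open>?G c2 \<le> (\<integral>x. arctan x \<partial>\<nu>)
  \<le> ?G c1\<close>, against \<open>?G c1 < ?G c2\<close>. The function \<open>arctan\<close> is
  bounded and continuous, as weak convergence requires, and strictly increasing, which separates the
  two sides.\<close>

lemma objective_minimiser_unique:
  assumes lim: "\<And>a. a \<longlonglongrightarrow> \<alpha> \<Longrightarrow> converges_weakly (\<lambda>n. cond_kernel V t n (a n)) \<nu>"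
    and q1: "\<And>s. objective V t \<alpha> q1 \<le> objective V t \<alpha> s" and q2: "\<And>s. objective V t \<alpha> q2 \<le> objective V t \<alpha> s"
  shows "\<not> q1 < q2"
proof
  assume "q1 < q2"
  \<comment> \<open>The tilts exclude half-lines only up to points strictly inside the interval,
    since the gain vanishes at \<open>q1\<close> and \<open>q2\<close> themselves; two distinct
    thresholds keep the final inequality strict.\<close>
  then obtain c1 c2 where c: "q1 < c1" "c1 < c2" "c2 < q2" by (meson dense)
  have arctan: "continuous_on UNIV arctan" "\<bar>arctan x\<bar> \<le> pi / 2" "\<bar>- arctan x\<bar> \<le> pi / 2" for x
    using arctan_lbound[of x] arctan_ubound[of x] by (auto intro!: continuous_intros)
  have bd: "bounded (range arctan)" by (rule boundedI[of _ "pi / 2"]) (use arctan(2) in auto)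
  have conv: "(\<lambda>n. \<integral>x. arctan x \<partial>cond_kernel V t n (a n)) \<longlonglongrightarrow> (\<integral>x. arctan x \<partial>\<nu>)" if "a \<longlonglongrightarrow> \<alpha>" for a
    using lim[OF that] arctan(1) bd by (simp add: converges_weakly_def)
  have mean_mono: "spin_mean t n a s \<le> spin_mean t n a s'" if "s \<le> s'" for n a s s'
    using that t_pos unfolding spin_mean_def by (intro divide_right_mono diff_right_mono mult_left_mono) auto
  let ?G = "\<lambda>c. \<integral>x. arctan (((1 + t) * c - \<alpha>) / t + sqrt (1 + t) * x) \<partial>std_normal_distribution"
  have "?G c2 \<le> (\<integral>x. arctan x \<partial>\<nu>)"
  proof -
    have \<beta>: "(\<lambda>k. \<alpha> + 1 / real (Suc k)) \<longlonglongrightarrow> \<alpha>" by real_asymp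
    have "(\<lambda>n. measure (posterior V t n (\<alpha> + 1 / real (Suc k))) {..c2}) \<longlonglongrightarrow> 0" for k
    \<comment> \<open>Here \<open>q2\<close> minimises the unshifted objective and serves merely as
      a competitor for the shifted one. For \<open>s \<le> c2\<close> the unshifted difference is
      nonnegative and the linear tilt contributes at least \<open>\<eta>\<close>.\<close>
    proof (rule posterior_tendsto_0[OF tendsto_const, where \<eta> = "1 / real (Suc k) * (q2 - c2) / t" and q = q2])
      show "0 < 1 / real (Suc k) * (q2 - c2) / t" using c t_pos by simp
      fix s assume "s \<in> {..c2}"
      then have "1 / real (Suc k) * (q2 - c2) / t \<le> 1 / real (Suc k) * (q2 - s) / t"
        using t_pos by (intro divide_right_mono mult_left_mono) auto
      then show "objective V t (\<alpha> + 1 / real (Suc k)) q2 + 1 / real (Suc k) * (q2 - c2) / t \<le> objective V t (\<alpha> + 1 / real (Suc k)) s"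
        using objective_shift[of "\<alpha> + 1 / real (Suc k)" s q2 \<alpha>] q2[of s] by simp
    qed simp
    from posterior_tendsto_0_diagonal[OF \<beta> this] obtain a where a: "a \<longlonglongrightarrow> \<alpha>"
      "(\<lambda>n. measure (posterior V t n (a n)) {..c2}) \<longlonglongrightarrow> 0" by blast
    show ?thesis
      by (rule limit_ge_if_posterior_concentrates[OF arctan(1,2) a(1) _ a(2) _ conv[OF a(1)]])
        (auto simp: arctan_le_iff intro!: mean_mono)
  qed
  moreover have "- (\<integral>x. arctan x \<partial>\<nu>) \<ge> - ?G c1"
  proof -
    have \<beta>: "(\<lambda>k. \<alpha> - 1 / real (Suc k)) \<longlonglongrightarrow> \<alpha>" by real_asymp
    have "(\<lambda>n. measure (posterior V t n (\<alpha> - 1 / real (Suc k))) {c1..}) \<longlonglongrightarrow> 0" for k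
    proof (rule posterior_tendsto_0[OF tendsto_const, where \<eta> = "1 / real (Suc k) * (c1 - q1) / t" and q = q1])
      show "0 < 1 / real (Suc k) * (c1 - q1) / t" using c t_pos by simp
      fix s assume "s \<in> {c1..}"
      then have "1 / real (Suc k) * (c1 - q1) / t \<le> 1 / real (Suc k) * (s - q1) / t"
        using t_pos by (intro divide_right_mono mult_left_mono) auto
      also have "\<dots> = - (1 / real (Suc k)) * (q1 - s) / t" by (simp only: minus_mult_commute minus_diff_eq)
      finally show "objective V t (\<alpha> - 1 / real (Suc k)) q1 + 1 / real (Suc k) * (c1 - q1) / t \<le> objective V t (\<alpha> - 1 / real (Suc k)) s"
        using objective_shift[of "\<alpha> - 1 / real (Suc k)" s q1 \<alpha>] q1[of s] by simp
    qed simp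
    from posterior_tendsto_0_diagonal[OF \<beta> this] obtain a where a: "a \<longlonglongrightarrow> \<alpha>"
      "(\<lambda>n. measure (posterior V t n (a n)) {c1..}) \<longlonglongrightarrow> 0" by blast
    \<comment> \<open>The auxiliary lemma gives lower bounds; applied to the decreasing function
      \<open>- arctan\<close> it bounds the limit from above.\<close>
    have "(\<integral>x. - arctan (((1 + t) * c1 - \<alpha>) / t + sqrt (1 + t) * x) \<partial>std_normal_distribution) \<le> - (\<integral>x. arctan x \<partial>\<nu>)"
    proof (rule limit_ge_if_posterior_concentrates[OF _ arctan(3) a(1) _ a(2)])
      show "(\<lambda>n. \<integral>x. - arctan x \<partial>cond_kernel V t n (a n)) \<longlonglongrightarrow> - (\<integral>x. arctan x \<partial>\<nu>)"
        using tendsto_minus[OF conv[OF a(1)]] by simp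
    qed (auto simp: arctan_le_iff intro!: mean_mono continuous_intros)
    then show ?thesis by simp
  qed
  moreover have "?G c1 < ?G c2"
  proof -
    have int: "integrable std_normal_distribution (\<lambda>x. arctan (m + sqrt (1 + t) * x))" for m
      by (rule std.integrable_const_bound[where B = "pi / 2"]) (use arctan(2) in auto)
    have "((1 + t) * c1 - \<alpha>) / t < ((1 + t) * c2 - \<alpha>) / t"
      using c t_pos by (intro divide_strict_right_mono) auto
    then have "0 < (\<integral>x. arctan (((1 + t) * c2 - \<alpha>) / t + sqrt (1 + t) * x) - arctan (((1 + t) * c1 - \<alpha>) / t + sqrt (1 + t) * x) \<partial>std_normal_distribution)"
      by (intro std.integral_pos Bochner_Integration.integrable_diff int) (auto simp: arctan_less_iff)
    then show ?thesis using int by simp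
  qed
  ultimately show False by simp
qed

text \<open>A minimiser always exists by coercivity, so uniqueness can fail only through two
  distinct minimisers, which are ordered one way or the other.\<close>

lemma good_magnetisation_iff:
  "good_magnetisation (time_evolved V t) \<alpha> \<longleftrightarrow> (\<exists>!q. global_minimiser (rate V t \<alpha>) q)"
  unfolding global_minimiser_rate_iff
proof
  assume "good_magnetisation (time_evolved V t) \<alpha>"
  then obtain \<nu> where \<nu>: "\<And>a. a \<longlonglongrightarrow> \<alpha> \<Longrightarrow> converges_weakly (\<lambda>n. cond_kernel V t n (a n)) \<nu>"
    by (auto simp: good_magnetisation_def limiting_cond_prob_iff)
  obtain q where q: "\<forall>s. objective V t \<alpha> q \<le> objective V t \<alpha> s" using objective_minimiser_exists by blast
  show "\<exists>!q. \<forall>s. objective V t \<alpha> q \<le> objective V t \<alpha> s"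
  proof (rule ex1I[of _ q])
    fix r assume r: "\<forall>s. objective V t \<alpha> r \<le> objective V t \<alpha> s"
    have "\<not> r < q"
      by (rule objective_minimiser_unique[OF \<nu> r[rule_format] q[rule_format]])
    moreover have "\<not> q < r"
      by (rule objective_minimiser_unique[OF \<nu> q[rule_format] r[rule_format]])
    ultimately show "r = q" by simp
  qed (rule q)
next
  assume "\<exists>!q. \<forall>s. objective V t \<alpha> q \<le> objective V t \<alpha> s"
  then obtain q where q: "(\<forall>s. objective V t \<alpha> r \<le> objective V t \<alpha> s) \<longleftrightarrow> r = q" for r
    by (auto elim!: ex1E)
  have "limiting_cond_prob (time_evolved V t) \<alpha> (normal_distr (((1 + t) * q - \<alpha>) / t) (1 + t))"
    unfolding limiting_cond_prob_iff
    by (intro conjI allI impI cond_kernel_converges_weakly q prob_space_normal_distr one_plus_t_pos sets_normal_distr)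
  then show "good_magnetisation (time_evolved V t) \<alpha>"
    unfolding good_magnetisation_def ..
qed

lemma limiting_cond_prob_iff_eq_normal:
  assumes q: "\<And>r. global_minimiser (rate V t \<alpha>) r \<longleftrightarrow> r = q" and V: "V differentiable at q"
  shows "limiting_cond_prob (time_evolved V t) \<alpha> \<nu> \<longleftrightarrow> \<nu> = normal_distr (- deriv V q) (1 + t)"
proof -
  let ?N = "normal_distr (- deriv V q) (1 + t)"
  have q': "(\<forall>s. objective V t \<alpha> r \<le> objective V t \<alpha> s) \<longleftrightarrow> r = q" for r
    using q[of r] by (simp add: global_minimiser_rate_iff)
  have mean: "((1 + t) * q - \<alpha>) / t = - deriv V q"
    using q'[of q] by (intro objective_minimiser_deriv V) auto
  have conv: "converges_weakly (\<lambda>n. cond_kernel V t n (a n)) ?N" if "a \<longlonglongrightarrow> \<alpha>" for a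
    using cond_kernel_converges_weakly[OF q' that] by (simp only: mean)
  have prob: "prob_space ?N" by (rule prob_space_normal_distr[OF one_plus_t_pos])
  show ?thesis
  proof
    assume "limiting_cond_prob (time_evolved V t) \<alpha> \<nu>"
    \<comment> \<open>The constant sequence is enough to identify the limit, since bounded
      continuous functions separate probability measures on the line.\<close>
    then have \<nu>: "prob_space \<nu>" "sets \<nu> = sets borel" "converges_weakly (\<lambda>n. cond_kernel V t n \<alpha>) \<nu>"
      by (auto simp: limiting_cond_prob_iff)
    show "\<nu> = ?N"
    proof (rule eq_if_integral_bounded_continuous_eq[OF \<nu>(1,2) prob sets_normal_distr])
      fix f :: "real \<Rightarrow> real" assume "continuous_on UNIV f" "bounded (range f)"
      then show "(\<integral>x. f x \<partial>\<nu>) = (\<integral>x. f x \<partial>?N)"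
        using \<nu>(3) conv[OF tendsto_const] unfolding converges_weakly_def by (blast intro: LIMSEQ_unique)
    qed
  next
    assume "\<nu> = ?N"
    then show "limiting_cond_prob (time_evolved V t) \<alpha> \<nu>"
      using conv prob by (simp add: limiting_cond_prob_iff)
  qed
qed

end

theorem theorem2:
  fixes V :: "real \<Rightarrow> real" and t :: real
  assumes "V C1_differentiable_on UNIV" and "\<And>x. 0 \<le> V x" and "0 < t"
  shows "(\<forall>\<alpha>. good_magnetisation (time_evolved V t) \<alpha> \<longleftrightarrow>
              (\<exists>!q. global_minimiser (rate V t \<alpha>) q)) \<and>
         (\<forall>\<alpha> q. good_magnetisation (time_evolved V t) \<alpha> \<and>
              (\<forall>r. global_minimiser (rate V t \<alpha>) r \<longleftrightarrow> r = q) \<longrightarrow>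
              (\<forall>\<nu>. limiting_cond_prob (time_evolved V t) \<alpha> \<nu> \<longleftrightarrow>
                   \<nu> = normal_distr (- deriv V q) (1 + t))) \<and>
         (sequentially_gibbs (time_evolved V t) \<longleftrightarrow>
              (\<forall>\<alpha>. \<exists>!q. global_minimiser (rate V t \<alpha>) q))"
proof -
  interpret mean_field V t
    using assms by unfold_locales (auto intro: C1_differentiable_imp_continuous_on)
  have "V differentiable at q" for q
    using assms(1) by (simp add: C1_differentiable_on_eq)
  then show ?thesis
    using good_magnetisation_iff limiting_cond_prob_iff_eq_normal by (auto simp: sequentially_gibbs_def)
qed

end
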